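(* Let $\mathbb{F}_q$ be a finite field of characteristic $p$, and let $k,m,d_1,\ldots,d_m$ be positive integers such that $m\leq\frac{k-1}{2}$ and $2\leq d_1<d_2<\cdots<d_m$. Suppose that $p$ does not divide $d_i$ for $1\leq i\leq m$. Let $b_1,\ldots,b_m\in\mathbb{F}_q$, $f_j:=X_1^{d_j}+\cdots+X_k^{d_j}-b_j\in\mathbb{F}_q[X_1,\ldots,X_k]$ for $1\leq j\leq m$, and let $|V(\mathbb{F}_q)|$ be the number of points $(x_1,\ldots,x_k)\in\mathbb{F}_q^k$ with $f_1(x)=\cdots=f_m(x)=0$. Then $$\left||V(\mathbb{F}_q)|-q^{k-m}\right|\leq 3^3\cdot 2^{m-1}(3+d_m m)^{k+1}\, q^{\frac{k}{2}}.$$ *)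

theory Defs
  imports Complex_Main "HOL-Library.Cardinality"
begin

definition diag_points :: "nat \<Rightarrow> nat \<Rightarrow> (nat \<Rightarrow> nat) \<Rightarrow> (nat \<Rightarrow> 'a::field) \<Rightarrow> 'a list set" where
  "diag_points k m d b = {xs. length xs = k \<and>
      (\<forall>j\<in>{1..m}. (\<Sum>i<k. (xs ! i) ^ d j) - b j = 0)}"

end

(*
  Expand the number of points in additive characters psi of F_q: up to the trivial character it is
  q^(-m) times a sum of k-th powers of S(u) = sum_x psi(u_1 x^(d_1) + ... + u_m x^(d_m)), so it suffices
  to know Weil's bound |S| <= (d - 1) sqrt q for one polynomial f of degree d prime to p.

  The analogous sums S_n over F_(q^n) satisfy S_n = - sum_i w_i^n for d - 1 complex numbers w_i, because
  the generating function of psi(sum of f over the roots of g), g monic over F_q, is a polynomial of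
  degree < d whose logarithmic derivative generates the S_n.  Monic polynomials are handled as
  Frobenius-invariant multisets over the algebraic closure.

  It remains to see S_(2h) = O(q^h), which forces |w_i| <= sqrt q.  With r = q^h and
  Y = sum_(i<h) f^(q^i), the trace of f(x) from F_(r^2) is Y(x) + Y(x)^r.  Counting coefficients gives
  polynomials s_ab, not all 0, of degree < r/q with sum s_ab^r X^a (c - Y)^b = 0.  At every x in F_(r^2) with trace c,
  the left side is the r-th power of the value of G = sum s_ab X^(ra) Y^b; and G is nonzero of degree
  r^2/q + O(r), because its terms have distinct degrees.
*)
theory Submission
  imports Defs "HOL-Algebra.Algebraic_Closure_Type"
    "HOL-Computational_Algebra.Computational_Algebra"
begin

section \<open>Finite fields\<close>

text \<open>The auxiliary polynomial G bounds each trace fibre from above only. That suffices: the q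
  fibres partition F_(q^(2h)), so upper bounds q^(2h-1) + O(q^h) for all of them control the total
  deviation in both directions, and the main term cancels because psi sums to 0. Even degrees are
  special since there the trace splits into two halves, Y and Y^r; the r-th power map thus turns
  large powers of x and Y into small powers of x and c - Y. Bounds in even degrees are enough
  because power sums of the numbers w_i^2 / q that stay bounded leave no room for one of modulus
  above 1, whatever the bound.

  That p does not divide d enters twice. Changing the d-th elementary symmetric function of the
  roots of g by t changes the sum of f by lead_coeff f * d * t up to sign, which makes the
  L-coefficients vanish from d on; and the numbers q a + d b with b < q are pairwise distinct, which
  makes G nonzero.

  Multisets replace products over irreducible polynomials: the logarithmic derivative of the Euler
  product becomes a double count of Frobenius orbits inside invariant multisets.\<close>

lemma prime_CHAR: "prime CHAR('a::{finite,field})"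
  using finite_imp_CHAR_pos[where ?'a='a] prime_CHAR_semidom[where ?'a='a] by simp

section \<open>Additive subgroups and the order of a finite field\<close>

definition add_subgroup :: "'a::ab_group_add set \<Rightarrow> bool" where
  "add_subgroup H \<longleftrightarrow> 0 \<in> H \<and> (\<forall>x\<in>H. \<forall>y\<in>H. x - y \<in> H)"

lemma add_subgroupD:
  assumes "add_subgroup H"
  shows "0 \<in> H" and "x \<in> H \<Longrightarrow> y \<in> H \<Longrightarrow> x - y \<in> H" and "x \<in> H \<Longrightarrow> - x \<in> H"
    and "x \<in> H \<Longrightarrow> y \<in> H \<Longrightarrow> x + y \<in> H"
proof -
  show *: "x - y \<in> H" if "x \<in> H" "y \<in> H" for x y
    using assms that by (auto simp: add_subgroup_def)
  show "0 \<in> H" using assms by (auto simp: add_subgroup_def)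
  show neg: "- x \<in> H" if "x \<in> H" for x using *[OF \<open>0 \<in> H\<close> that] by simp
  show "x + y \<in> H" if "x \<in> H" "y \<in> H" using *[OF that(1) neg[OF that(2)]] by simp
qed

lemma add_subgroup_of_nat_mult:
  fixes H :: "'a::comm_ring_1 set"
  assumes "add_subgroup H" "x \<in> H"
  shows "of_nat n * x \<in> H"
  by (induction n) (auto simp: algebra_simps add_subgroupD[OF assms(1)] assms(2))

lemma of_nat_mod_CHAR: "of_nat (n mod CHAR('a)) = (of_nat n :: 'a::semiring_1)"
proof -
  have "of_nat n = (of_nat (CHAR('a) * (n div CHAR('a)) + n mod CHAR('a)) :: 'a)" by simp
  then show ?thesis unfolding of_nat_add of_nat_mult by simp
qed

text \<open>Two representations of one element would put j v into H for some 0 < j < p. As j is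
  invertible modulo p, a multiple of j v equals v, which is not in H.\<close>

lemma inj_on_subgroup_extension:
  fixes v :: "'a::{finite,field}"
  assumes H: "add_subgroup H" and v: "v \<notin> H"
  shows "inj_on (\<lambda>(k, h). of_nat k * v + h) ({..<CHAR('a)} \<times> H)"
proof -
  have *: "k = k'" if kk: "k < CHAR('a)" "k' < CHAR('a)" "k \<le> k'"
    and h: "h \<in> H" "h' \<in> H" and eq: "of_nat k * v + h = of_nat k' * v + h'" for k k' h h'
  proof (rule ccontr)
    assume "k \<noteq> k'"
    define j where "j = k' - k"
    have j: "0 < j" "j < CHAR('a)" using kk \<open>k \<noteq> k'\<close> by (auto simp: j_def)
    have "coprime j CHAR('a)"
      using prime_CHAR[where ?'a='a] j by (metis coprime_commute nat_dvd_not_less prime_imp_coprime)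
    then obtain i y where i: "j * i = CHAR('a) * y + 1"
      using bezout_nat[of j "CHAR('a)"] j by auto
    have "of_nat j * v = h - h'" using eq kk(3) by (simp add: j_def of_nat_diff algebra_simps)
    then have "of_nat j * v \<in> H" using h H by (simp add: add_subgroupD)
    then have "of_nat i * (of_nat j * v) \<in> H" by (rule add_subgroup_of_nat_mult[OF H])
    moreover have "of_nat (j * i) = (of_nat 1 :: 'a)"
      unfolding i by simp
    moreover have "of_nat i * (of_nat j * v) = of_nat (j * i) * v" by (simp add: mult_ac)
    ultimately show False using v by simp
  qed
  show ?thesis
  proof (rule inj_onI)
    fix x y :: "nat \<times> 'a"
    assume A: "x \<in> {..<CHAR('a)} \<times> H" "y \<in> {..<CHAR('a)} \<times> H"
      and eq: "(case x of (k, h) \<Rightarrow> of_nat k * v + h) = (case y of (k, h) \<Rightarrow> of_nat k * v + h)"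
    obtain k h k' h' where xy: "x = (k, h)" "y = (k', h')" by (cases x, cases y)
    have eq': "of_nat k * v + h = of_nat k' * v + h'" using eq unfolding xy by (simp only: prod.case)
    have "k = k'"
    proof (cases "k \<le> k'")
      case True
      show ?thesis by (rule *[OF _ _ True _ _ eq']) (use A xy in auto)
    next
      case False
      then have le: "k' \<le> k" by simp
      show ?thesis by (rule *[OF _ _ le _ _ eq'[symmetric], symmetric]) (use A xy in auto)
    qed
    then show "x = y" using eq' xy by (metis add_left_cancel)
  qed
qed

lemma add_subgroup_extension:
  fixes v :: "'a::{finite,field}"
  assumes H: "add_subgroup H"
  shows "add_subgroup ((\<lambda>(k, h). of_nat k * v + h) ` ({..<CHAR('a)} \<times> H))" (is "add_subgroup ?E")
proof -
  have p0: "CHAR('a) > 0" using prime_CHAR[where ?'a='a] prime_gt_0_nat by blast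
  have mem: "of_nat k * v + h \<in> ?E" if "h \<in> H" for k h
  proof -
    have "of_nat (k mod CHAR('a)) = (of_nat k :: 'a)" by (rule of_nat_mod_CHAR)
    then show ?thesis using that p0 by (force intro!: image_eqI[of _ _ "(k mod CHAR('a), h)"])
  qed
  show ?thesis unfolding add_subgroup_def
  proof (intro conjI ballI)
    show "0 \<in> ?E" using mem[of 0 0] H by (simp add: add_subgroupD)
    fix x y assume "x \<in> ?E" "y \<in> ?E"
    then obtain k h k' h' where *: "x = of_nat k * v + h" "y = of_nat k' * v + h'" "h \<in> H" "h' \<in> H"
      and k': "k' < CHAR('a)" by auto
    \<comment> \<open>The coefficient - k' is written as p - k' to stay within the naturals;
      \<open>mem\<close> then reduces modulo p.\<close>
    have "x - y = of_nat (k + (CHAR('a) - k')) * v + (h - h')"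
      using k' by (simp add: * of_nat_diff algebra_simps)
    then show "x - y \<in> ?E" using mem[OF add_subgroupD(2)[OF H *(3,4)]] by metis
  qed
qed

lemma ex_max_card:
  fixes S :: "'a::finite set set"
  assumes "A \<in> S"
  shows "\<exists>H\<in>S. \<forall>H'\<in>S. card H' \<le> card H"
proof -
  have "Max (card ` S) \<in> card ` S" using assms by (intro Max_in) auto
  then obtain H where "H \<in> S" "card H = Max (card ` S)" by auto
  then show ?thesis using Max_ge[of "card ` S"] by (intro bexI[of _ H]) auto
qed

text \<open>A subgroup that is largest among those of p-power order must be everything: adjoining a
  missing v would multiply its order by p.\<close>

lemma card_eq_CHAR_power: "\<exists>e. CARD('a::{finite,field}) = CHAR('a) ^ e"
proof -
  define S where "S = {H :: 'a set. add_subgroup H \<and> (\<exists>e. card H = CHAR('a) ^ e)}"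
  have "{0} \<in> S"
    by (auto simp: S_def add_subgroup_def intro!: exI[of _ 0])
  from ex_max_card[OF this]
  obtain H where H: "H \<in> S" "\<And>H'. H' \<in> S \<Longrightarrow> card H' \<le> card H"
    by auto
  have "H = UNIV"
  proof (rule ccontr)
    assume "H \<noteq> UNIV"
    then obtain v where v: "v \<notin> H" by auto
    let ?E = "(\<lambda>(k, h). of_nat k * v + h) ` ({..<CHAR('a)} \<times> H)"
    obtain e where e: "add_subgroup H" "card H = CHAR('a) ^ e" using H(1) by (auto simp: S_def)
    have c: "card ?E = CHAR('a) * card H"
      by (subst card_image[OF inj_on_subgroup_extension[OF e(1) v]]) (simp add: card_cartesian_product)
    have "?E \<in> S" unfolding S_def using add_subgroup_extension[OF e(1)]
      by (auto simp: c e(2) intro!: exI[of _ "Suc e"])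
    then have "card ?E \<le> card H" by (rule H(2))
    moreover have "card H > 0" using e(2) prime_CHAR[where ?'a='a] by (simp add: prime_gt_0_nat)
    moreover have "CHAR('a) > 1" using prime_CHAR[where ?'a='a] prime_gt_1_nat by blast
    ultimately show False using c by simp
  qed
  then show ?thesis using H(1) by (auto simp: S_def)
qed

section \<open>Additive characters\<close>

locale additive_character =
  fixes \<psi> :: "'a::{finite,field} \<Rightarrow> complex"
  assumes add: "\<psi> (x + y) = \<psi> x * \<psi> y"
    and nontrivial: "\<exists>x. \<psi> x \<noteq> 1"
    and norm_eq_1 [simp]: "norm (\<psi> x) = 1"

text \<open>A maximal proper subgroup H has index p: with any v outside H, every x is k v + h for a
  unique k < p. Then x goes to exp (2 pi i k / p), a character with kernel H.\<close>

lemma ex_additive_character: "\<exists>\<psi> :: 'a::{finite,field} \<Rightarrow> complex. additive_character \<psi>"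
proof -
  define p where "p = CHAR('a)"
  have p1: "p > 1" using prime_CHAR[where ?'a='a] prime_gt_1_nat p_def by blast
  define S where "S = {H :: 'a set. add_subgroup H \<and> H \<noteq> UNIV}"
  have "{0::'a} \<noteq> UNIV" using zero_neq_one[where ?'a='a] by (metis UNIV_I singletonD)
  then have "{0::'a} \<in> S" by (auto simp: S_def add_subgroup_def)
  from ex_max_card[OF this]
  obtain H where H: "H \<in> S" "\<And>H'. H' \<in> S \<Longrightarrow> card H' \<le> card H"
    by auto
  from H(1) obtain v where v: "v \<notin> H" and sub: "add_subgroup H" by (auto simp: S_def)
  define F where "F = (\<lambda>(k, h). of_nat k * v + h :: 'a)"
  have inj: "inj_on F ({..<p} \<times> H)"
    unfolding F_def p_def by (rule inj_on_subgroup_extension[OF sub v])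
  have "card (F ` ({..<p} \<times> H)) = p * card H"
    by (subst card_image[OF inj]) (simp add: card_cartesian_product)
  moreover have "card H > 0" using add_subgroupD(1)[OF sub] by (auto simp: card_gt_0_iff)
  ultimately have "card (F ` ({..<p} \<times> H)) > card H" using p1 by simp
  then have "F ` ({..<p} \<times> H) \<notin> S" using H(2) by (meson linorder_not_less)
  then have "F ` ({..<p} \<times> H) = UNIV"
    using add_subgroup_extension[OF sub] unfolding F_def p_def S_def by blast
  then have "x \<in> F ` ({..<p} \<times> H)" for x by simp
  then have "\<exists>k h. k < p \<and> h \<in> H \<and> x = of_nat k * v + h" for x
    unfolding F_def by fast
  then obtain k h where kh: "\<And>x. k x < p" "\<And>x. h x \<in> H" "\<And>x. of_nat (k x) * v + h x = x"
    by metis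
  \<comment> \<open>Representations of x with an arbitrary natural coefficient j occur when two
    elements are added; only j modulo p matters.\<close>
  have uniq: "k x = j mod p" if "x = of_nat j * v + g" "g \<in> H" for x j g
  proof -
    have "of_nat (j mod p) = (of_nat j :: 'a)" unfolding p_def by (rule of_nat_mod_CHAR)
    then have "F (j mod p, g) = F (k x, h x)" using that(1) by (simp add: F_def kh(3))
    moreover have "(j mod p, g) \<in> {..<p} \<times> H" "(k x, h x) \<in> {..<p} \<times> H" using that kh p1 by auto
    ultimately have "(j mod p, g) = (k x, h x)" by (rule inj_onD[OF inj])
    then show ?thesis by simp
  qed
  define e where "e n = cis (2 * pi * real n / real p)" for n
  have e_add: "e (m + n) = e m * e n" for m n
    by (simp add: e_def cis_mult add_divide_distrib distrib_left)
  have e_p: "e (p * n) = 1" for n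
  proof -
    have "2 * pi * real (p * n) / real p = 2 * pi * of_nat n" using p1 by simp
    then show ?thesis unfolding e_def by (simp add: cis_multiple_2pi)
  qed
  have e_mod: "e (n mod p) = e n" for n
    using e_add[of "p * (n div p)" "n mod p"] by (simp add: e_p)
  have "additive_character (\<lambda>x. e (k x))"
  proof
    fix x y :: 'a
    have "x + y = of_nat (k x + k y) * v + (h x + h y)"
      using arg_cong2[OF kh(3)[of x] kh(3)[of y], of "(+)"] by (simp add: distrib_right add_ac)
    then have "k (x + y) = (k x + k y) mod p" by (rule uniq) (simp add: kh(2) sub add_subgroupD)
    then show "e (k (x + y)) = e (k x) * e (k y)" by (simp add: e_mod e_add)
  next
    have "k v = 1" using uniq[of v 1 0] p1 sub by (simp add: add_subgroupD)
    moreover have "e 1 \<noteq> 1"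
    proof
      assume "e 1 = 1"
      then have "cos (2 * pi / real p) = 1" by (auto simp: e_def complex_eq_iff)
      then obtain n :: int where n: "2 * pi / real p = of_int n * 2 * pi" using cos_one_2pi_int by blast
      then have "1 = real p * of_int n" using p1 by (simp add: field_simps)
      then have "real_of_int (int p * n) = real_of_int 1" by simp
      then have "int p * n = 1" unfolding of_int_eq_iff .
      then show False using p1 by (simp add: zmult_eq_1_iff)
    qed
    ultimately show "\<exists>x. e (k x) \<noteq> 1" by metis
  qed (simp add: e_def)
  then show ?thesis by blast
qed

context additive_character
begin

lemma psi_0 [simp]: "\<psi> 0 = 1"
  using add[of 0 0] norm_eq_1[of 0] by (metis add_0 mult_cancel_left norm_zero zero_neq_one mult.right_neutral)

lemma psi_sum: "\<psi> (\<Sum>x\<in>A. f x) = (\<Prod>x\<in>A. \<psi> (f x))"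
  by (induction A rule: infinite_finite_induct) (auto simp: add)

lemma sum_psi_mult: "(\<Sum>x\<in>UNIV. \<psi> (c * x)) = (if c = 0 then of_nat CARD('a) else 0)"
proof (cases "c = 0")
  case False
  obtain y where y: "\<psi> y \<noteq> 1" using nontrivial by blast
  have "(\<Sum>x\<in>UNIV. \<psi> (c * x)) = (\<Sum>x\<in>UNIV. \<psi> (c * (x + y / c)))"
    by (rule sum.reindex_bij_witness[of _ "\<lambda>x. x + y / c" "\<lambda>x. x - y / c"]) auto
  also have "\<dots> = \<psi> y * (\<Sum>x\<in>UNIV. \<psi> (c * x))"
    using False by (simp add: distrib_left add sum_distrib_left mult_ac)
  finally show ?thesis using y False by simp
qed auto

end

section \<open>Frobenius powers and the extension fields\<close>

lemma CARD_ge_2: "CARD('a::{finite,field}) \<ge> 2"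
proof -
  have "card {0, 1 :: 'a} \<le> CARD('a)" by (intro card_mono) auto
  then show ?thesis by simp
qed

text \<open>The semiring is left general because this is applied both to the algebraic closure and
  to the polynomial ring over F_q.\<close>

lemma power_card_add:
  fixes x y :: "'b::comm_semiring_1"
  assumes "CHAR('b) = CHAR('a::{finite,field})"
  shows "(x + y) ^ (CARD('a) ^ n) = x ^ (CARD('a) ^ n) + y ^ (CARD('a) ^ n)"
proof -
  obtain e where e: "CARD('a) = CHAR('a) ^ e" using card_eq_CHAR_power by blast
  show ?thesis
    by (rule freshmans_dream'[of _ "e * n"]) (simp_all add: e assms prime_CHAR power_mult)
qed

lemma power_card_sum:
  fixes f :: "'c \<Rightarrow> 'b::comm_semiring_1"
  assumes "CHAR('b) = CHAR('a::{finite,field})"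
  shows "(\<Sum>x\<in>A. f x) ^ (CARD('a) ^ n) = (\<Sum>x\<in>A. f x ^ (CARD('a) ^ n))"
  by (induction A rule: infinite_finite_induct) (simp_all add: power_card_add[OF assms] power_0_left)

lemma power_card_eq_self: "x ^ (CARD('a) ^ n) = (x :: 'a::{finite,field})"
proof -
  have *: "x ^ CARD('a) = x"
  proof (cases "x = 0")
    case False
    \<comment> \<open>Multiplication by x permutes the nonzero elements.\<close>
    have "\<Prod>(UNIV - {0}) = (\<Prod>y\<in>UNIV - {0}. x * y)"
      by (rule prod.reindex_bij_witness[of _ "\<lambda>y. x * y" "\<lambda>y. y / x"]) (use False in auto)
    also have "\<dots> = x ^ (CARD('a) - 1) * \<Prod>(UNIV - {0})"
      by (simp add: prod.distrib)
    finally have "x ^ (CARD('a) - 1) = 1" by simp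
    moreover have "CARD('a) = Suc (CARD('a) - 1)" using CARD_ge_2[where ?'a='a] by simp
    ultimately show ?thesis by (metis mult.right_neutral power_Suc)
  qed (use CARD_ge_2[where ?'a='a] in simp)
  show ?thesis by (induction n) (simp_all add: * power_mult mult.commute)
qed

text \<open>The copy of F_(q^n) in the algebraic closure, for n > 0. For n = 0 the condition is void
  and the set is the whole closure.\<close>

definition ext_field :: "nat \<Rightarrow> 'a::{finite,field} alg_closure set" where
  "ext_field n = {x. x ^ (CARD('a) ^ n) = x}"

lemma card_poly_roots_le:
  fixes p :: "'b::idom poly"
  assumes "p \<noteq> 0" "\<And>x. x \<in> A \<Longrightarrow> poly p x = 0"
  shows "finite A" "card A \<le> degree p"
proof -
  have *: "A \<subseteq> {x. poly p x = 0}" using assms(2) by auto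
  show "finite A" using finite_subset[OF *] poly_roots_finite[OF assms(1)] by simp
  show "card A \<le> degree p"
    using card_mono[OF poly_roots_finite[OF assms(1)] *] card_poly_roots_bound[OF assms(1)] by simp
qed

lemma prod_linear_factors_nonzero: "(\<Prod>x\<in>#A. [:-x, 1::'b::idom:]) \<noteq> 0"
  by auto

lemma proots_prod_linear_factors: "proots (\<Prod>x\<in>#A. [:-x, 1::'b::idom:]) = A"
proof (induction A)
  case (add x A)
  have "[:-x, 1:] * (\<Prod>x\<in>#A. [:-x, 1:]) \<noteq> 0"
    using prod_linear_factors_nonzero[of "add_mset x A"] by simp
  then show ?case using add proots_linear_factor[of "-x"] by (simp add: proots_mult del: mult_pCons_left)
qed simp

lemma prod_proots_eq_monic:
  fixes P :: "'b::alg_closed_field poly"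
  assumes "lead_coeff P = 1"
  shows "(\<Prod>x\<in>#proots P. [:-x, 1:]) = P"
proof -
  have "P \<noteq> 0" using assms by auto
  then obtain A where "P = (\<Prod>x\<in>#A. [:-x, 1:])"
    using alg_closed_imp_factorization[of P] assms by auto
  then show ?thesis by (simp only: proots_prod_linear_factors)
qed

lemma degree_prod_linear_factors: "Polynomial.degree (\<Prod>x\<in>#A. [:-x, 1::'b::idom:]) = size A"
proof (induction A)
  case (add x A)
  have "Polynomial.degree ([:-x, 1:] * (\<Prod>x\<in>#A. [:-x, 1:])) = 1 + size A"
    by (subst degree_mult_eq) (use prod_linear_factors_nonzero add in auto)
  then show ?case by (simp del: mult_pCons_left)
qed simp

lemma monic_prod_linear_factors: "lead_coeff (\<Prod>x\<in>#A. [:-x, 1::'b::idom:]) = 1"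
  by (induction A) (auto simp: lead_coeff_mult simp del: mult_pCons_left)

lemma size_proots_monic:
  fixes P :: "'b::alg_closed_field poly"
  assumes "lead_coeff P = 1"
  shows "size (proots P) = Polynomial.degree P"
  using degree_prod_linear_factors[of "proots P"] prod_proots_eq_monic[OF assms] by simp

text \<open>X^N - X has derivative -1, since p divides N. It is therefore separable and has exactly
  N distinct roots in the closure.\<close>

lemma
  assumes "n > 0"
  shows finite_ext_field: "finite (ext_field n :: 'a::{finite,field} alg_closure set)"
    and card_ext_field: "card (ext_field n :: 'a alg_closure set) = CARD('a) ^ n"
proof -
  define N where "N = CARD('a) ^ n"
  define P where "P = monom 1 N - [:0, 1 :: 'a alg_closure:]"
  have N2: "N > 1" unfolding N_def using assms CARD_ge_2[where ?'a='a] by (intro one_less_power) auto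
  have deg: "degree P = N" unfolding P_def diff_conv_add_uminus using N2
    by (subst degree_add_eq_left) (auto simp: degree_monom_eq)
  have P0: "P \<noteq> 0" using deg N2 by auto
  have roots: "{x. poly P x = 0} = ext_field n" by (auto simp: P_def ext_field_def N_def poly_monom)
  have "CHAR('a) dvd N"
  proof -
    obtain e where e: "CARD('a) = CHAR('a) ^ e" using card_eq_CHAR_power by blast
    have "e > 0" using e CARD_ge_2[where ?'a='a] by (cases e) auto
    then show ?thesis using assms unfolding N_def e by (simp add: dvd_power flip: power_mult)
  qed
  then have N0: "of_nat N = (0 :: 'a alg_closure)" by (simp add: of_nat_eq_0_iff_char_dvd)
  have pd: "pderiv P = -1"
    unfolding P_def by (simp add: pderiv_diff pderiv_monom N0 pderiv_pCons one_pCons)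
  \<comment> \<open>A double root would also be a root of the derivative -1.\<close>
  have ord: "Polynomial.order x P = 1" if "poly P x = 0" for x
  proof (rule ccontr)
    assume "Polynomial.order x P \<noteq> 1"
    moreover have "Polynomial.order x P \<noteq> 0" using that P0 order_root by blast
    ultimately have "[:-x, 1:] ^ 2 dvd P" by (simp add: order_divides)
    then obtain k where "P = [:-x, 1:] ^ 2 * k" by (elim dvdE)
    then have "poly (pderiv P) x = poly (pderiv ([:-x, 1:] * ([:-x, 1:] * k))) x"
      by (simp only: power2_eq_square mult.assoc)
    also have "\<dots> = 0" by (subst pderiv_mult, subst poly_add, subst (1 2) poly_mult, subst poly_mult) simp
    finally have "poly (pderiv P) x = 0" .
    then show False by (simp add: pd)
  qed
  have "lead_coeff P = 1" unfolding deg using N2 by (simp add: P_def coeff_pCons split: nat.splits)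
  then have size: "size (proots P) = N" using deg by (simp add: size_proots_monic)
  have "proots P = mset_set {x. poly P x = 0}"
  proof (rule multiset_eqI)
    fix x
    show "count (proots P) x = count (mset_set {x. poly P x = 0}) x"
      using P0 ord[of x] poly_roots_finite[OF P0] order_root[of P x]
      by (cases "poly P x = 0") auto
  qed
  then have "size (proots P) = card {x. poly P x = 0}" by simp
  then show "card (ext_field n :: 'a alg_closure set) = CARD('a) ^ n"
    using size roots N_def by simp
  show "finite (ext_field n :: 'a alg_closure set)"
    using poly_roots_finite[OF P0] roots by simp
qed

lemma range_to_ac: "range to_ac = (ext_field 1 :: 'a::{finite,field} alg_closure set)"
proof (rule card_subset_eq)
  show "finite (ext_field 1 :: 'a alg_closure set)" by (rule finite_ext_field) simp
  show "range to_ac \<subseteq> (ext_field 1 :: 'a alg_closure set)"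
    using power_card_eq_self[where n=1] by (auto simp: ext_field_def simp flip: to_ac_power)
  show "card (range (to_ac :: 'a \<Rightarrow> _)) = card (ext_field 1 :: 'a alg_closure set)"
    by (simp add: card_image[OF inj_to_ac] card_ext_field)
qed

lemma in_range_to_ac_iff: "x \<in> range to_ac \<longleftrightarrow> x ^ CARD('a) = (x :: 'a::{finite,field} alg_closure)"
  by (simp add: range_to_ac ext_field_def)

lemma CHAR_ac: "CHAR('a::{finite,field} alg_closure) = CHAR('a)"
  by simp

section \<open>Polynomials over F_q evaluated in the closure\<close>

abbreviation ac_poly :: "'a::{finite,field} poly \<Rightarrow> 'a alg_closure poly" where
  "ac_poly \<equiv> map_poly to_ac"

lemma coeff_ac_poly [simp]: "poly.coeff (ac_poly p) n = to_ac (poly.coeff p n)"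
  by (simp add: coeff_map_poly)

lemma degree_ac_poly [simp]: "degree (ac_poly p) = degree p"
  by (rule degree_map_poly) auto

lemma ac_poly_add: "ac_poly (p + q) = ac_poly p + ac_poly q"
  by (rule poly_eqI) simp

lemma ac_poly_mult: "ac_poly (p * q) = ac_poly p * ac_poly q"
  by (rule poly_eqI) (simp add: coeff_mult to_ac_sum)

lemma ac_poly_eq_iff [simp]: "ac_poly p = ac_poly q \<longleftrightarrow> p = q"
  by (simp add: poly_eq_iff)

lemma ac_poly_0 [simp]: "ac_poly 0 = 0" and ac_poly_1 [simp]: "ac_poly 1 = 1"
  by (auto simp: poly_eq_iff)

lemma ac_poly_power: "ac_poly (p ^ n) = ac_poly p ^ n"
  by (induction n) (auto simp: ac_poly_mult)

lemma ac_poly_sum: "ac_poly (\<Sum>x\<in>A. f x) = (\<Sum>x\<in>A. ac_poly (f x))"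
  by (induction A rule: infinite_finite_induct) (auto simp: ac_poly_add)

lemma poly_ac_poly_to_ac: "poly (ac_poly f) (to_ac x) = to_ac (poly f x)"
  by (simp add: poly_altdef to_ac_sum)

lemma poly_ac_poly_power_card:
  fixes f :: "'a::{finite,field} poly"
  shows "poly (ac_poly f) x ^ (CARD('a) ^ n) = poly (ac_poly f) (x ^ (CARD('a) ^ n))"
proof -
  have "poly (ac_poly f) x ^ (CARD('a) ^ n)
      = (\<Sum>i\<le>Polynomial.degree f. (to_ac (poly.coeff f i) * x ^ i) ^ (CARD('a) ^ n))"
    unfolding poly_altdef degree_ac_poly coeff_ac_poly by (rule power_card_sum[OF CHAR_ac])
  also have "\<dots> = (\<Sum>i\<le>Polynomial.degree f. to_ac (poly.coeff f i) * (x ^ (CARD('a) ^ n)) ^ i)"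
    by (intro sum.cong refl, unfold power_mult_distrib to_ac_power[symmetric] power_card_eq_self)
      (simp add: mult.commute flip: power_mult)
  finally show ?thesis unfolding poly_altdef degree_ac_poly coeff_ac_poly .
qed

section \<open>Stepanov's method for trace equations\<close>

text \<open>Vanishing coefficients instead of a degree bound: n = 0 then gives {0}, so the
  cardinality q^n holds without exception, and closure under subtraction is immediate.\<close>

definition polys_lt :: "nat \<Rightarrow> 'a::zero poly set" where
  "polys_lt n = {p. \<forall>i\<ge>n. poly.coeff p i = 0}"

lemma polys_lt_iff_degree: "n > 0 \<Longrightarrow> p \<in> polys_lt n \<longleftrightarrow> Polynomial.degree p < n"
  by (auto simp: polys_lt_def coeff_eq_0 not_le intro!: degree_lessI)

lemma polys_lt_I: "Polynomial.degree p < n \<Longrightarrow> p \<in> polys_lt n"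
  by (auto simp: polys_lt_def coeff_eq_0)

lemma
  shows finite_polys_lt: "finite (polys_lt n :: 'a::{finite,zero} poly set)"
    and card_polys_lt: "card (polys_lt n :: 'a poly set) = CARD('a) ^ n"
proof -
  have "bij_betw (\<lambda>p. map (poly.coeff p) [0..<n]) (polys_lt n :: 'a poly set)
          {xs. set xs \<subseteq> UNIV \<and> length xs = n}"
    by (rule bij_betw_byWitness[of _ Poly])
       (auto simp: polys_lt_def poly_eq_iff coeff_Poly_eq nth_default_def intro!: nth_equalityI)
  then show "finite (polys_lt n :: 'a poly set)" "card (polys_lt n :: 'a poly set) = CARD('a) ^ n"
    using bij_betw_finite finite_lists_length_eq[of "UNIV :: 'a set" n]
      bij_betw_same_card card_lists_length_eq[of "UNIV :: 'a set" n] by force+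
qed

text \<open>The term of largest degree has nothing to cancel against.\<close>

lemma sum_distinct_degrees_nonzero:
  fixes t :: "'i \<Rightarrow> 'b::comm_monoid_add poly"
  assumes "finite I" "i0 \<in> I" "t i0 \<noteq> 0"
    and inj: "\<And>i j. i \<in> I \<Longrightarrow> j \<in> I \<Longrightarrow> t i \<noteq> 0 \<Longrightarrow> t j \<noteq> 0
        \<Longrightarrow> Polynomial.degree (t i) = Polynomial.degree (t j) \<Longrightarrow> i = j"
  shows "(\<Sum>i\<in>I. t i) \<noteq> 0"
proof -
  define J where "J = {i\<in>I. t i \<noteq> 0}"
  have J: "finite J" "J \<noteq> {}" using assms by (auto simp: J_def)
  obtain k where k: "k \<in> J" "\<And>j. j \<in> J \<Longrightarrow> Polynomial.degree (t j) \<le> Polynomial.degree (t k)"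
    using finite_imageI[OF J(1), of "Polynomial.degree \<circ> t"] Max_in[of "(Polynomial.degree \<circ> t) ` J"]
       Max_ge[of "(Polynomial.degree \<circ> t) ` J"] J(2)
    by (smt (verit) comp_apply image_iff image_is_empty)
  have "poly.coeff (\<Sum>i\<in>I. t i) (Polynomial.degree (t k))
      = (\<Sum>i\<in>I. poly.coeff (t i) (Polynomial.degree (t k)))"
    by (simp add: coeff_sum)
  also have "\<dots> = (\<Sum>i\<in>{k}. poly.coeff (t i) (Polynomial.degree (t k)))"
  proof (rule sum.mono_neutral_right)
    show "\<forall>i\<in>I - {k}. poly.coeff (t i) (Polynomial.degree (t k)) = 0"
    proof
      fix i assume i: "i \<in> I - {k}"
      show "poly.coeff (t i) (Polynomial.degree (t k)) = 0"
      proof (cases "t i = 0")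
        case False
        then have "Polynomial.degree (t i) < Polynomial.degree (t k)"
          using i k inj[of i k] by (fastforce simp: J_def order.order_iff_strict)
        then show ?thesis by (rule coeff_eq_0)
      qed simp
    qed
  qed (use k assms in \<open>auto simp: J_def\<close>)
  also have "\<dots> \<noteq> 0" using k by (simp add: J_def)
  finally show ?thesis by auto
qed

lemma degree_sum_card_powers:
  fixes f :: "'a::{finite,field} poly"
  assumes "Polynomial.degree f \<ge> 1"
  shows "Polynomial.degree (\<Sum>i<Suc h. f ^ (CARD('a) ^ i)) = Polynomial.degree f * CARD('a) ^ h"
proof (induction h)
  case (Suc h)
  have f0: "f \<noteq> 0" using assms by auto
  have "CARD('a) ^ h < CARD('a) ^ Suc h" using CARD_ge_2[where ?'a='a] by (intro power_strict_increasing) auto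
  then show ?case using assms f0 Suc
    by (subst sum.lessThan_Suc, subst degree_add_eq_right) (auto simp: degree_power_eq mult.commute)
qed simp

text \<open>The points of the fibre are roots of one nonzero polynomial G, and the right side bounds
  its degree. In the proof r = q^h and u = r / q; each s_ab has u free coefficients.\<close>

lemma card_trace_fibre_le:
  fixes f :: "'a::{finite,field} poly" and c :: 'a
  defines "d \<equiv> Polynomial.degree f" and "q \<equiv> CARD('a)"
  assumes d: "d \<ge> 1" and cop: "coprime d q" and h: "h > 0"
  shows "card {x \<in> ext_field (2 * h). (\<Sum>i<2*h. poly (ac_poly f) x ^ (q ^ i)) = to_ac c}
     \<le> q ^ (2 * h - 1) + (2 * d + 1) * q ^ h" (is "card ?N \<le> _")
proof -
  have q2: "q \<ge> 2" unfolding q_def by (rule CARD_ge_2)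
  define u where "u = q ^ (h - 1)"
  define r where "r = q ^ h"
  have r: "r = q * u" unfolding r_def u_def using h by (cases h) auto
  have u1: "u \<ge> 1" unfolding u_def using q2 by simp
  have r1: "r \<ge> 1" using r u1 q2 by simp
  define Y where "Y = (\<Sum>i<h. f ^ (q ^ i))"
  have degY: "Polynomial.degree Y = d * u"
    using degree_sum_card_powers[of f "h - 1"] d h by (simp add: Y_def q_def d_def u_def)
  have Y0: "Y \<noteq> 0" using degY d u1 by auto
  have frob: "(x + y) ^ r = x ^ r + y ^ r" for x y :: "'a poly"
    unfolding r_def q_def by (rule power_card_add) simp
  have frob_diff: "(x - y) ^ r = x ^ r - y ^ r" for x y :: "'a poly"
    using frob[of "x - y" y] by simp
  define I where "I = {..<u + d} \<times> {..<q}"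
  have finI: "finite I" by (simp add: I_def)
  define T where "T = (\<Pi>\<^sub>E i\<in>I. (polys_lt u :: 'a poly set))"
  define H where "H s = (\<Sum>(a, b)\<in>I. s (a, b) ^ r * monom 1 a * ([:c:] - Y) ^ b)" for s :: "nat \<times> nat \<Rightarrow> 'a poly"
  \<comment> \<open>The three products bound the degrees of s_ab^r, X^a and (c - Y)^b; adding 1
    counts the coefficients of \<open>H s\<close>.\<close>
  define D where "D = r * (u - 1) + (u + d - 1) + d * u * (q - 1) + 1"
  have finT: "finite T" unfolding T_def by (intro finite_PiE finI finite_polys_lt)
  have cardT: "card T = q ^ (u * ((u + d) * q))"
    unfolding T_def using finI by (simp add: card_PiE card_polys_lt q_def I_def power_mult)
  \<comment> \<open>The range a < u + d is chosen so that the free coefficients outnumber the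
    conditions: the difference is u (q - 1) + d (u - 1), which is positive.\<close>
  have less: "D < u * ((u + d) * q)"
  proof -
    obtain v where v: "u = Suc v" using u1 by (cases u) auto
    obtain w where w: "q = Suc (Suc w)" using q2 by (metis Suc_diff_Suc le_eq_less_or_eq less_eq_Suc_le numeral_2_eq_2 add_2_eq_Suc le_Suc_ex)
    show ?thesis unfolding D_def r v w using d by (simp add: algebra_simps)
  qed
  have HD: "H ` T \<subseteq> polys_lt D"
  proof safe
    fix s assume s: "s \<in> T"
    have "Polynomial.degree (s (a, b) ^ r * monom 1 a * ([:c:] - Y) ^ b) \<le> D - 1" if ab: "(a, b) \<in> I" for a b
    proof -
      have "s (a, b) \<in> polys_lt u" using s ab by (auto simp: T_def)
      then have "Polynomial.degree (s (a, b)) \<le> u - 1" using u1 by (simp add: polys_lt_iff_degree)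
      then have 1: "Polynomial.degree (s (a, b) ^ r) \<le> r * (u - 1)"
        using degree_power_le[of "s (a, b)" r] by (metis le_trans mult.commute mult_le_mono2)
      have 2: "Polynomial.degree (monom 1 a :: 'a poly) \<le> u + d - 1"
        using ab by (auto simp: I_def degree_monom_eq)
      have "Polynomial.degree ([:c:] - Y) \<le> d * u" using degY by (intro degree_diff_le) auto
      then have "Polynomial.degree (([:c:] - Y) ^ b) \<le> d * u * b"
        using degree_power_le[of "[:c:] - Y" b] by (meson le_trans mult_le_mono1)
      also have "\<dots> \<le> d * u * (q - 1)" using ab by (intro mult_le_mono2) (auto simp: I_def)
      finally have 3: "Polynomial.degree (([:c:] - Y) ^ b) \<le> d * u * (q - 1)" .
      have "Polynomial.degree (s (a, b) ^ r * monom 1 a * ([:c:] - Y) ^ b)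
        \<le> Polynomial.degree (s (a, b) ^ r) + Polynomial.degree (monom 1 a :: 'a poly)
          + Polynomial.degree (([:c:] - Y) ^ b)"
        by (meson add_le_mono1 degree_mult_le le_trans)
      then show ?thesis using 1 2 3 unfolding D_def by linarith
    qed
    then have "Polynomial.degree (H s) \<le> D - 1"
      unfolding H_def by (intro degree_sum_le finI) auto
    then show "H s \<in> polys_lt D" by (intro polys_lt_I) (simp add: D_def)
  qed
  \<comment> \<open>Pigeonhole instead of linear algebra: the r-th power map is additive, so the
    difference of two tuples with the same image under \<open>H\<close> is a nonzero solution of
    \<open>H s = 0\<close>.\<close>
  have "\<not> inj_on H T"
  proof
    assume "inj_on H T"
    then have "card T \<le> card (polys_lt D :: 'a poly set)"
      by (rule card_inj_on_le[OF _ HD finite_polys_lt])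
    then have "q ^ (u * ((u + d) * q)) \<le> q ^ D" using cardT by (simp add: card_polys_lt q_def)
    then show False using less q2 by (simp add: power_le_imp_le_exp leD power_increasing_iff)
  qed
  then obtain s1 s2 where s12: "s1 \<in> T" "s2 \<in> T" "s1 \<noteq> s2" "H s1 = H s2" by (auto simp: inj_on_def)
  define s where "s i = s1 i - s2 i" for i
  obtain i0 where i0: "i0 \<in> I" "s i0 \<noteq> 0"
    using PiE_ext[OF s12(1)[unfolded T_def] s12(2)[unfolded T_def]] s12(3) by (auto simp: s_def)
  have s_lt: "Polynomial.degree (s i) < u" if "i \<in> I" for i
  proof -
    have "s1 i \<in> polys_lt u" "s2 i \<in> polys_lt u" using that s12 by (auto simp: T_def)
    then have "s i \<in> polys_lt u" by (auto simp: polys_lt_def s_def)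
    then show ?thesis using u1 by (simp add: polys_lt_iff_degree)
  qed
  have "H s = H s1 - H s2"
    unfolding H_def s_def by (simp add: frob_diff left_diff_distrib sum_subtractf case_prod_unfold)
  then have Hs: "H s = 0" using s12 by simp
  \<comment> \<open>G is built so that its r-th power agrees with \<open>H s\<close> on the fibre:
    there x^(r a) raised to the power r is x^a, and Y^b becomes (c - Y)^b.\<close>
  define t where "t = (\<lambda>(a, b). s (a, b) * monom 1 (r * a) * Y ^ b)"
  define G where "G = (\<Sum>i\<in>I. t i)"
  have deg_t: "Polynomial.degree (t (a, b)) = Polynomial.degree (s (a, b)) + (q * a + d * b) * u"
    if "s (a, b) \<noteq> 0" for a b
    using that Y0 by (simp add: t_def degree_mult_eq degree_monom_eq degree_power_eq degY monom_eq_0_iff r algebra_simps)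
  have t0: "t (a, b) = 0 \<longleftrightarrow> s (a, b) = 0" for a b
    using Y0 by (simp add: t_def monom_eq_0_iff)
  have "G \<noteq> 0" unfolding G_def
  proof (rule sum_distinct_degrees_nonzero[OF finI i0(1)])
    show "t i0 \<noteq> 0" using i0 t0 by (metis surj_pair)
  next
    fix i j assume ij: "i \<in> I" "j \<in> I" "t i \<noteq> 0" "t j \<noteq> 0" "Polynomial.degree (t i) = Polynomial.degree (t j)"
    obtain a b a' b' where ab: "i = (a, b)" "j = (a', b')" by (cases i, cases j)
    \<comment> \<open>Since \<open>degree (s i) < u\<close>, division by u recovers q a + d b. Its
      class modulo q determines b, because d is prime to q and b < q; then a follows.\<close>
    have "(Polynomial.degree (s i) + (q * a + d * b) * u) div u = (Polynomial.degree (s j) + (q * a' + d * b') * u) div u"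
      using ij ab by (simp add: t0 deg_t)
    then have eq: "q * a + d * b = q * a' + d * b'" using s_lt[OF ij(1)] s_lt[OF ij(2)] u1 by simp
    have *: "b = b'" if "b \<le> b'" "b < q" "b' < q" "q * a + d * b = q * a' + d * b'" for a b a' b'
    proof -
      have "int d * (int b' - int b) = int q * (int a - int a')"
        using arg_cong[OF that(4), of int] by (simp add: algebra_simps)
      then have "int q dvd int d * (int b' - int b)" by simp
      then have "int q dvd int b' - int b" using cop by (simp add: coprime_commute coprime_dvd_mult_right_iff)
      then have "q dvd b' - b" using that(1) by (metis int_dvd_int_iff of_nat_diff)
      then show "b = b'" using that by (metis diff_is_0_eq dvd_imp_le le_antisym less_imp_diff_less linorder_not_less not_gr_zero)
    qed
    have "b = b'" using *[of b b' a a'] *[of b' b a' a] eq ij ab by (cases "b \<le> b'") (auto simp: I_def)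
    then show "i = j" using eq q2 ab by simp
  qed
  have deg_t_le: "Polynomial.degree (t i) \<le> q ^ (2 * h - 1) + (2 * d + 1) * q ^ h" if "i \<in> I" for i
  proof -
    obtain a b where ab: "i = (a, b)" by (cases i)
    show ?thesis
    proof (cases "s (a, b) = 0")
      case False
      have "(q * a + d * b) * u = r * a + d * b * u" by (simp add: r algebra_simps)
      \<comment> \<open>As q u = r, this is r u + 2 d r. The factor s_ab contributes less than u <=
        r, whence the constant 2 d + 1, and r u = q^(2h-1).\<close>
      also have "\<dots> \<le> r * (u + d) + d * q * u" using that ab by (intro add_mono mult_le_mono) (auto simp: I_def)
      finally have "Polynomial.degree (t i) \<le> u + (r * (u + d) + d * q * u)"
        using deg_t[OF False] s_lt[OF that] ab by simp
      also have "\<dots> \<le> r * u + (2 * d + 1) * r" using q2 by (simp add: r algebra_simps)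
      also have "r * u = q ^ (2 * h - 1)" unfolding r_def u_def using h by (simp flip: power_add) (metis One_nat_def Suc_pred add_Suc_right diff_Suc_1 mult_2)
      finally show ?thesis by (simp add: r_def)
    next
      case True
      then have "t i = 0" using t0 ab by simp
      then show ?thesis by simp
    qed
  qed
  have degG: "Polynomial.degree G \<le> q ^ (2 * h - 1) + (2 * d + 1) * q ^ h"
    unfolding G_def by (intro degree_sum_le finI deg_t_le)
  have root: "poly (ac_poly G) x = 0" if "x \<in> ?N" for x
  proof -
    have xQ: "x ^ (r * r) = x" using that by (simp add: ext_field_def r_def q_def mult_2 flip: power_add)
    define y where "y = poly (ac_poly Y) x"
    have y: "y = (\<Sum>i<h. poly (ac_poly f) x ^ (q ^ i))"
      by (simp add: y_def Y_def ac_poly_sum ac_poly_power poly_sum)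
    have frobK: "(\<Sum>x\<in>A. g x) ^ r = (\<Sum>x\<in>A. g x ^ r)" for g :: "'z \<Rightarrow> 'a alg_closure" and A
      unfolding r_def q_def by (rule power_card_sum) simp
    have "y ^ r = (\<Sum>i<h. poly (ac_poly f) x ^ (q ^ (i + h)))"
      unfolding y frobK by (simp add: r_def power_add flip: power_mult)
    moreover have "to_ac c = y + (\<Sum>i<h. poly (ac_poly f) x ^ (q ^ (i + h)))"
    proof -
      \<comment> \<open>The second half of the trace sum is the first half y shifted by h steps of
        Frobenius, that is y^r.\<close>
      have "{..<2 * h} = {..<h} \<union> {0 + h..<h + h}" by auto
      then have "to_ac c = (\<Sum>i\<in>{..<h} \<union> {0 + h..<h + h}. poly (ac_poly f) x ^ (q ^ i))" using that by simp
      also have "\<dots> = y + (\<Sum>i\<in>{0 + h..<h + h}. poly (ac_poly f) x ^ (q ^ i))"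
        unfolding y by (subst sum.union_disjoint) auto
      also have "\<dots> = y + (\<Sum>i<h. poly (ac_poly f) x ^ (q ^ (i + h)))"
        unfolding sum.shift_bounds_nat_ivl by (simp add: lessThan_atLeast0)
      finally show ?thesis .
    qed
    ultimately have yr: "y ^ r = to_ac c - y" by simp
    have "poly (ac_poly G) x ^ r = (\<Sum>(a, b)\<in>I. (poly (ac_poly (s (a, b))) x * x ^ (r * a) * y ^ b) ^ r)"
      by (simp add: G_def t_def ac_poly_sum poly_sum frobK case_prod_unfold ac_poly_mult ac_poly_power y_def map_poly_monom poly_monom)
    also have "\<dots> = (\<Sum>(a, b)\<in>I. poly (ac_poly (s (a, b))) x ^ r * x ^ a * (to_ac c - y) ^ b)"
    proof (intro sum.cong refl, clarify)
      fix a b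
      have "(x ^ (r * a)) ^ r = (x ^ (r * r)) ^ a" by (simp add: mult_ac flip: power_mult)
      moreover have "(y ^ b) ^ r = (y ^ r) ^ b" by (simp add: mult_ac flip: power_mult)
      ultimately show "(poly (ac_poly (s (a, b))) x * x ^ (r * a) * y ^ b) ^ r
          = poly (ac_poly (s (a, b))) x ^ r * x ^ a * (to_ac c - y) ^ b"
        by (simp add: power_mult_distrib xQ yr)
    qed
    also have "\<dots> = poly (ac_poly (H s)) x"
    proof -
      have "ac_poly ([:c:] - Y) = [:to_ac c:] - ac_poly Y"
        by (rule poly_eqI) (simp add: coeff_pCons split: nat.splits)
      then show ?thesis
        by (simp add: H_def ac_poly_sum poly_sum case_prod_unfold ac_poly_mult ac_poly_power y_def map_poly_monom poly_monom)
    qed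
    also have "\<dots> = 0" by (simp add: Hs)
    finally show ?thesis using r1 by simp
  qed
  have "card ?N \<le> Polynomial.degree (ac_poly G)"
  proof (rule card_poly_roots_le(2))
    show "ac_poly G \<noteq> 0" using \<open>G \<noteq> 0\<close> by (metis ac_poly_0 ac_poly_eq_iff)
  qed (rule root)
  then show ?thesis using degG by simp
qed

section \<open>Traces and exponential sums over extensions of even degree\<close>

definition ext_trace :: "nat \<Rightarrow> 'a::{finite,field} alg_closure \<Rightarrow> 'a alg_closure" where
  "ext_trace n y = (\<Sum>i<n. y ^ (CARD('a) ^ i))"

text \<open>Raising to the power q shifts the summation index by one, and y^(q^n) = y closes the
  cycle; so the trace is fixed by Frobenius.\<close>

lemma ext_trace_in_range:
  fixes y :: "'a::{finite,field} alg_closure"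
  assumes "y \<in> ext_field n"
  shows "ext_trace n y \<in> range to_ac"
proof -
  have "ext_trace n y ^ CARD('a) = (\<Sum>i<n. y ^ (CARD('a) ^ Suc i))"
    unfolding ext_trace_def using power_card_sum[OF CHAR_ac, of "\<lambda>i. y ^ (CARD('a) ^ i)" "{..<n}" 1]
    by (simp add: mult.commute flip: power_mult)
  also have "\<dots> = ext_trace n y"
    using assms sum.lessThan_Suc[of "\<lambda>i. y ^ (CARD('a) ^ i)" n]
      sum.lessThan_Suc_shift[of "\<lambda>i. y ^ (CARD('a) ^ i)" n]
    by (simp add: ext_trace_def ext_field_def)
  finally show ?thesis by (simp add: in_range_to_ac_iff)
qed

lemma poly_in_ext_field: "x \<in> ext_field n \<Longrightarrow> poly (ac_poly f) x \<in> ext_field n"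
  by (simp add: ext_field_def poly_ac_poly_power_card)

context additive_character
begin

definition ext_sum :: "'a poly \<Rightarrow> nat \<Rightarrow> complex" where
  "ext_sum f n = (\<Sum>x\<in>ext_field n. \<psi> (of_ac (ext_trace n (poly (ac_poly f) x))))"

text \<open>Let D c be the deviation of a fibre from the average q^(2h-1). The average cancels
  against the sum of psi, and the D c sum to 0, so the upper bound D c <= B already controls the sum
  of their absolute values.\<close>

lemma norm_ext_sum_even_le:
  assumes "Polynomial.degree f \<ge> 1" "coprime (Polynomial.degree f) CARD('a)" "h > 0"
  shows "norm (ext_sum f (2 * h))
    \<le> 2 * real CARD('a) * (2 * real (Polynomial.degree f) + 1) * real CARD('a) ^ h"
proof -
  define q where "q = CARD('a)"
  define d where "d = Polynomial.degree f"
  define E where "E = (ext_field (2 * h) :: 'a alg_closure set)"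
  define tr where "tr x = of_ac (ext_trace (2 * h) (poly (ac_poly f) x))" for x
  have fin: "finite E" unfolding E_def using assms by (intro finite_ext_field) auto
  have tr: "to_ac (tr x) = (\<Sum>i<2*h. poly (ac_poly f) x ^ (q ^ i))" if "x \<in> E" for x
    using ext_trace_in_range[OF poly_in_ext_field, of x "2 * h" f] that
    by (simp add: tr_def to_ac_of_ac E_def) (simp add: ext_trace_def q_def)
  define N where "N c = card {x\<in>E. tr x = c}" for c
  define D where "D c = real (N c) - real q ^ (2 * h - 1)" for c
  define B where "B = (2 * real d + 1) * real q ^ h"
  have B0: "B \<ge> 0" by (simp add: B_def)
  have DB: "D c \<le> B" for c
  proof -
    have "{x\<in>E. tr x = c} = {x \<in> ext_field (2 * h). (\<Sum>i<2*h. poly (ac_poly f) x ^ (q ^ i)) = to_ac c}"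
      using tr by (auto simp: E_def) (metis to_ac_eq_iff)
    then have "N c \<le> q ^ (2 * h - 1) + (2 * d + 1) * q ^ h"
      using card_trace_fibre_le[of f h c] assms unfolding N_def q_def d_def by simp
    then have "real (N c) \<le> real (q ^ (2 * h - 1) + (2 * d + 1) * q ^ h)" by (rule of_nat_mono)
    then show ?thesis by (simp add: D_def B_def algebra_simps)
  qed
  have group: "(\<Sum>c\<in>UNIV. \<Sum>x\<in>{x\<in>E. tr x = c}. g x) = sum g E" for g :: "'a alg_closure \<Rightarrow> 'z::comm_monoid_add"
    by (rule sum.group) (use fin in auto)
  have "(\<Sum>c\<in>UNIV. N c) = card E" using group[of "\<lambda>_. 1::nat"] by (simp add: N_def)
  also have "\<dots> = q * q ^ (2 * h - 1)"
    using assms by (simp add: E_def card_ext_field q_def flip: power_Suc)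
  finally have "(\<Sum>c\<in>UNIV. real (N c)) = real q * real q ^ (2 * h - 1)"
    by (metis of_nat_mult of_nat_power of_nat_sum)
  then have sumD: "(\<Sum>c\<in>UNIV. D c) = 0" by (simp add: D_def sum_subtractf q_def)
  have "ext_sum f (2 * h) = (\<Sum>x\<in>E. \<psi> (tr x))" by (simp add: ext_sum_def E_def tr_def)
  also have "\<dots> = (\<Sum>c\<in>UNIV. \<Sum>x\<in>{x\<in>E. tr x = c}. \<psi> (tr x))" by (rule group[symmetric])
  also have "\<dots> = (\<Sum>c\<in>UNIV. \<psi> c * of_nat (N c))" by (simp add: N_def mult.commute)
  also have "\<dots> = (\<Sum>c\<in>UNIV. \<psi> c * of_real (D c))"
    using sum_psi_mult[of 1] by (simp add: D_def algebra_simps sum_subtractf flip: sum_distrib_right sum_distrib_left)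
  finally have "norm (ext_sum f (2 * h)) \<le> (\<Sum>c\<in>UNIV. norm (\<psi> c * of_real (D c)))"
    by (simp add: norm_sum)
  also have "\<dots> = (\<Sum>c\<in>UNIV. \<bar>D c\<bar>)" by (simp add: norm_mult)
  \<comment> \<open>For D c >= 0 this is D c <= B, otherwise it is B >= 0. Summation removes the D c
    and leaves 2 q B.\<close>
  also have "\<dots> \<le> (\<Sum>c\<in>UNIV. 2 * B - D c)"
    by (intro sum_mono) (use DB B0 in \<open>simp add: abs_le_iff; smt (verit)\<close>)
  also have "\<dots> = 2 * real q * B" using sumD by (simp add: sum_subtractf q_def)
  finally show ?thesis by (simp add: B_def q_def d_def mult_ac)
qed

end

section \<open>Newton's identities\<close>

text \<open>The k-th coefficient is (-1)^k times the k-th elementary symmetric function of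
  M.\<close>

definition rev_char_fps :: "'b::comm_ring_1 multiset \<Rightarrow> 'b fps" where
  "rev_char_fps M = (\<Prod>x\<in>#M. 1 - fps_const x * fps_X)"

definition power_sum :: "'b::comm_ring_1 multiset \<Rightarrow> nat \<Rightarrow> 'b" where
  "power_sum M k = (\<Sum>x\<in>#M. x ^ k)"

lemma rev_char_fps_add_mset: "rev_char_fps (add_mset x M) = (1 - fps_const x * fps_X) * rev_char_fps M"
  by (simp add: rev_char_fps_def)

lemma rev_char_fps_nth_0 [simp]: "fps_nth (rev_char_fps M) 0 = 1"
  by (induction M) (simp_all add: rev_char_fps_add_mset, simp add: rev_char_fps_def)

lemma rev_char_fps_nth_Suc_add_mset:
  "fps_nth (rev_char_fps (add_mset x M)) (Suc k)
     = fps_nth (rev_char_fps M) (Suc k) - x * fps_nth (rev_char_fps M) k"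
  by (simp add: rev_char_fps_add_mset left_diff_distrib mult.assoc)

lemma geometric_fps: "(1 - fps_const x * fps_X) * Abs_fps (\<lambda>k. x ^ Suc k) = fps_const (x :: 'b::comm_ring_1)"
proof (rule fps_ext)
  fix n show "fps_nth ((1 - fps_const x * fps_X) * Abs_fps (\<lambda>k. x ^ Suc k)) n = fps_nth (fps_const x) n"
    by (cases n) (simp_all add: left_diff_distrib mult.assoc)
qed

text \<open>The logarithmic derivative of the product of all 1 - x T, multiplied out; each factor
  contributes the geometric series of - x / (1 - x T).\<close>

lemma deriv_rev_char_fps: "fps_deriv (rev_char_fps M) = - rev_char_fps M * Abs_fps (\<lambda>k. power_sum M (Suc k))"
proof (induction M)
  case empty
  then show ?case by (simp add: rev_char_fps_def power_sum_def fps_eq_iff)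
next
  case (add x M)
  let ?L = "1 - fps_const x * fps_X" and ?E = "rev_char_fps M" and ?P = "Abs_fps (\<lambda>k. power_sum M (Suc k))"
  have P: "Abs_fps (\<lambda>k. power_sum (add_mset x M) (Suc k)) = Abs_fps (\<lambda>k. x ^ Suc k) + ?P"
    by (simp add: power_sum_def fps_eq_iff)
  have "fps_deriv (rev_char_fps (add_mset x M)) = - fps_const x * ?E - ?L * (?E * ?P)"
    by (simp add: rev_char_fps_add_mset add)
  also have "\<dots> = - (?L * Abs_fps (\<lambda>k. x ^ Suc k)) * ?E - ?L * (?E * ?P)"
    by (simp only: geometric_fps)
  also have "\<dots> = - (?L * ?E) * (Abs_fps (\<lambda>k. x ^ Suc k) + ?P)"
    by (simp add: algebra_simps)
  finally show ?case by (simp only: P rev_char_fps_add_mset)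
qed

lemma newton_identity:
  "of_nat (Suc k) * fps_nth (rev_char_fps M) (Suc k)
    = - (\<Sum>j\<le>k. fps_nth (rev_char_fps M) j * power_sum M (Suc k - j))"
proof -
  have "of_nat (Suc k) * fps_nth (rev_char_fps M) (Suc k) = fps_nth (fps_deriv (rev_char_fps M)) k"
    by (simp only: fps_deriv_nth Suc_eq_plus1)
  also have "\<dots> = - fps_nth (rev_char_fps M * Abs_fps (\<lambda>k. power_sum M (Suc k))) k"
    unfolding deriv_rev_char_fps by simp
  also have "\<dots> = - (\<Sum>j\<le>k. fps_nth (rev_char_fps M) j * power_sum M (Suc k - j))"
    by (simp add: fps_mult_nth atLeast0AtMost Suc_diff_le)
  finally show ?thesis .
qed

text \<open>Newton's identity is solved for the power sum and not for the elementary symmetric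
  function: division by \<open>Suc k\<close> may be impossible in characteristic p. The coefficient
  at j = 0 is 1.\<close>

lemma power_sum_Suc:
  "power_sum M (Suc k) = - of_nat (Suc k) * fps_nth (rev_char_fps M) (Suc k)
     - (\<Sum>j\<in>{1..k}. fps_nth (rev_char_fps M) j * power_sum M (Suc k - j))"
proof -
  have "{..k} = insert 0 {1..k}" by auto
  then have "(\<Sum>j\<le>k. fps_nth (rev_char_fps M) j * power_sum M (Suc k - j))
     = power_sum M (Suc k) + (\<Sum>j\<in>{1..k}. fps_nth (rev_char_fps M) j * power_sum M (Suc k - j))"
    by simp
  then have "of_nat (Suc k) * fps_nth (rev_char_fps M) (Suc k)
     = - (power_sum M (Suc k) + (\<Sum>j\<in>{1..k}. fps_nth (rev_char_fps M) j * power_sum M (Suc k - j)))"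
    using newton_identity[of k M] by metis
  then show ?thesis unfolding mult_minus_left by simp
qed

lemma power_sum_cong:
  assumes "\<And>k. k < d \<Longrightarrow> fps_nth (rev_char_fps M) k = fps_nth (rev_char_fps N) k" "0 < k" "k < d"
  shows "power_sum M k = power_sum N k"
  using assms(2,3)
proof (induction k rule: less_induct)
  case (less k)
  obtain j where j: "k = Suc j" using less.prems by (cases k) auto
  show ?case unfolding j power_sum_Suc
    by (intro arg_cong2[where f="(-)"] arg_cong2[where f="(*)"] refl sum.cong assms(1) less.IH) (use less.prems j in auto)
qed

lemma power_sum_diff:
  assumes "\<And>k. k < d \<Longrightarrow> fps_nth (rev_char_fps M) k = fps_nth (rev_char_fps N) k" "0 < d"
  shows "power_sum M d = power_sum N d
     - of_nat d * (fps_nth (rev_char_fps M) d - fps_nth (rev_char_fps N) d)"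
proof -
  obtain j where j: "d = Suc j" using assms(2) by (cases d) auto
  have "(\<Sum>i\<in>{1..j}. fps_nth (rev_char_fps M) i * power_sum M (Suc j - i))
     = (\<Sum>i\<in>{1..j}. fps_nth (rev_char_fps N) i * power_sum N (Suc j - i))"
    by (intro sum.cong refl arg_cong2[where f="(*)"] assms(1) power_sum_cong[OF assms(1)]) (auto simp: j)
  then show ?thesis unfolding j power_sum_Suc by (simp add: algebra_simps)
qed

text \<open>With g the product of the T - x and n = size M, the series is the reversal T^n g(1/T).
  Both claims share one induction since the first needs the second when j = size M.\<close>

lemma rev_char_fps_nth:
  fixes M :: "'b::idom multiset"
  shows "k \<le> size M \<Longrightarrow> fps_nth (rev_char_fps M) k = poly.coeff (\<Prod>x\<in>#M. [:-x, 1:]) (size M - k)"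
    and "k > size M \<Longrightarrow> fps_nth (rev_char_fps M) k = 0"
proof (induction M arbitrary: k)
  case empty
  { case 1 then show ?case by (simp add: rev_char_fps_def) }
  { case 2 then show ?case by (simp add: rev_char_fps_def) }
next
  case (add x M)
  let ?g = "\<Prod>x\<in>#M. [:-x, 1:]"
  { case 1
    show ?case
    proof (cases k)
      case 0
      then show ?thesis using monic_prod_linear_factors[of "add_mset x M"] degree_prod_linear_factors[of "add_mset x M"] by simp
    next
      case (Suc j)
      have "fps_nth (rev_char_fps (add_mset x M)) k = fps_nth (rev_char_fps M) (Suc j) - x * poly.coeff ?g (size M - j)"
        unfolding Suc rev_char_fps_nth_Suc_add_mset using add.IH(1)[of j] 1 Suc by simp
      also have "\<dots> = poly.coeff ([:-x, 1:] * ?g) (size M - j)"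
      proof (cases "j = size M")
        case True then show ?thesis using add.IH(2)[of "Suc j"] by simp
      next
        case False
        then have "size M - j = Suc (size M - Suc j)" using 1 Suc by simp
        then show ?thesis using add.IH(1)[of "Suc j"] 1 Suc False by simp
      qed
      finally show ?thesis using Suc by simp
    qed }
  { case 2
    then show ?case by (cases k) (simp_all add: rev_char_fps_nth_Suc_add_mset add.IH) }
qed

lemma sum_mset_poly:
  "(\<Sum>x\<in>#M. poly p x) = (\<Sum>i\<le>Polynomial.degree p. poly.coeff p i * power_sum M i)"
  by (induction M) (simp_all add: power_sum_def poly_altdef sum.distrib distrib_left)

text \<open>Power sums of order below \<open>d\<close> only see the first \<open>d - 1\<close> elementary symmetric functions,
  while the \<open>d\<close>-th one is affine in the \<open>d\<close>-th elementary symmetric function.\<close>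

lemma sum_mset_poly_diff:
  assumes "\<And>k. k < d \<Longrightarrow> fps_nth (rev_char_fps M) k = fps_nth (rev_char_fps N) k" "0 < d"
    "size M = size N" "Polynomial.degree p = d"
  shows "(\<Sum>x\<in>#M. poly p x) = (\<Sum>x\<in>#N. poly p x)
     - lead_coeff p * of_nat d * (fps_nth (rev_char_fps M) d - fps_nth (rev_char_fps N) d)"
proof -
  have "power_sum M i = power_sum N i" if "i < d" for i
  proof (cases "i = 0")
    case False
    then show ?thesis using that by (intro power_sum_cong[OF assms(1)]) auto
  qed (simp add: power_sum_def assms(3))
  then have *: "(\<Sum>i<d. poly.coeff p i * power_sum M i) = (\<Sum>i<d. poly.coeff p i * power_sum N i)"
    by simp
  have pd: "power_sum M d = power_sum N d - of_nat d * (fps_nth (rev_char_fps M) d - fps_nth (rev_char_fps N) d)"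
    by (rule power_sum_diff) (use assms in auto)
  show ?thesis
    unfolding sum_mset_poly assms(4) lessThan_Suc_atMost[symmetric] sum.lessThan_Suc * pd
    by (simp add: algebra_simps)
qed

section \<open>Bounded exponential sums\<close>

text \<open>The sequence shifted by one minus \<open>w\<close> times the sequence is again bounded and no longer involves \<open>w\<close>.\<close>

lemma bounded_exponential_sum:
  fixes c :: "complex \<Rightarrow> complex"
  assumes "finite A" "\<And>n. n > 0 \<Longrightarrow> norm (\<Sum>z\<in>A. c z * z ^ n) \<le> B" "z \<in> A" "c z \<noteq> 0"
  shows "norm z \<le> 1"
  using assms
proof (induction A arbitrary: c B z)
  case (insert w A)
  have IH: "norm z \<le> 1" if z: "z \<in> A" "c z \<noteq> 0" for z
  proof (rule insert.IH[where c = "\<lambda>z. c z * (z - w)" and B = "B + norm w * B" and z = z])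
    fix n :: nat assume n: "n > 0"
    have "(\<Sum>z\<in>A. c z * (z - w) * z ^ n) = (\<Sum>z\<in>insert w A. c z * z ^ Suc n) - w * (\<Sum>z\<in>insert w A. c z * z ^ n)"
      using insert.hyps by (simp add: algebra_simps sum_subtractf sum_distrib_left)
    also have "norm \<dots> \<le> B + norm w * B"
      using insert.prems(1)[of "Suc n"] insert.prems(1)[OF n]
      by (intro order.trans[OF norm_triangle_ineq4] add_mono) (auto simp: norm_mult intro!: mult_left_mono)
    finally show "norm (\<Sum>z\<in>A. c z * (z - w) * z ^ n) \<le> B + norm w * B" .
  next
    show "c z * (z - w) \<noteq> 0" using z insert.hyps by auto
  qed fact
  show ?case
  proof (cases "z = w")
    \<comment> \<open>By \<open>IH\<close> the other terms are bounded by norm (c z), so the term of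
      w is bounded as well. Powers of a number of norm above 1 are not.\<close>
    case True
    have cw: "c w \<noteq> 0" using insert.prems True by simp
    have "norm (w ^ n) \<le> (B + (\<Sum>z\<in>A. norm (c z))) / norm (c w)" if n: "n > 0" for n
    proof -
      have "c w * w ^ n = (\<Sum>z\<in>insert w A. c z * z ^ n) - (\<Sum>z\<in>A. c z * z ^ n)"
        using insert.hyps by simp
      also have "norm \<dots> \<le> B + (\<Sum>z\<in>A. norm (c z))"
      proof (intro order.trans[OF norm_triangle_ineq4] add_mono insert.prems(1) n order.trans[OF norm_sum] sum_mono)
        fix z assume "z \<in> A"
        then show "norm (c z * z ^ n) \<le> norm (c z)"
          using IH[of z] power_le_one[of "norm z" n] by (cases "c z = 0") (auto simp: norm_mult norm_power intro!: mult_left_le)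
      qed
      finally show ?thesis using cw by (simp add: norm_mult field_simps)
    qed
    note bd = this
    show ?thesis
    proof (rule ccontr)
      assume "\<not> norm z \<le> 1"
      then have "norm w > 1" using True by simp
      then obtain n where n: "(B + (\<Sum>z\<in>A. norm (c z))) / norm (c w) < norm w ^ n"
        using real_arch_pow by blast
      also have "\<dots> \<le> norm w ^ Suc n" using \<open>norm w > 1\<close> by (intro power_increasing) auto
      finally show False using bd[of "Suc n"] by (simp add: norm_power del: power_Suc)
    qed
  next
    case False
    then show ?thesis using IH insert.prems by auto
  qed
qed auto

lemma sum_mset_eq_sum_count:
  fixes f :: "'c \<Rightarrow> 'b::comm_semiring_1"
  assumes "finite A" "set_mset M \<subseteq> A"
  shows "(\<Sum>z\<in>#M. f z) = (\<Sum>z\<in>A. of_nat (count M z) * f z)"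
  using assms(2)
proof (induction M)
  case (add x M)
  have "(\<Sum>z\<in>A. of_nat (count (add_mset x M) z) * f z)
      = (\<Sum>z\<in>A. (if x = z then f z else 0) + of_nat (count M z) * f z)"
    by (intro sum.cong) (auto simp: algebra_simps)
  also have "\<dots> = f x + (\<Sum>z\<in>A. of_nat (count M z) * f z)"
    using add.prems assms(1) by (simp add: sum.distrib)
  finally show ?case using add by simp
qed simp

text \<open>The numbers w^2 / R have bounded power sums. Distinct w may share a square, but the
  coefficients are then multiplicities, positive and hence free of cancellation.\<close>

lemma norm_le_of_power_sums:
  fixes M :: "complex multiset"
  assumes "R > 0" "\<And>n. n > 0 \<Longrightarrow> norm (power_sum M (2 * n)) \<le> B * R ^ n" "w \<in># M"
  shows "norm w ^ 2 \<le> R"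
proof -
  define f where "f = (\<lambda>w :: complex. w ^ 2 / of_real R)"
  define M' where "M' = image_mset f M"
  have "norm (f w) \<le> 1"
  proof (rule bounded_exponential_sum)
    show "finite (set_mset M')" by simp
    show "f w \<in> set_mset M'" using assms(3) by (simp add: M'_def)
    show "complex_of_nat (count M' (f w)) \<noteq> 0"
      using assms(3) by (simp add: M'_def del: count_image_mset)
    fix n :: nat assume n: "n > 0"
    have "(\<Sum>z\<in>set_mset M'. of_nat (count M' z) * z ^ n) = (\<Sum>z\<in>#M'. z ^ n)"
      by (rule sum_mset_eq_sum_count[symmetric]) auto
    also have "\<dots> = power_sum M (2 * n) / of_real R ^ n"
      by (simp add: M'_def f_def power_sum_def image_mset.compositionality o_def power_divide
            sum_mset_distrib_right divide_inverse power_mult_distrib power_inverse flip: power_mult)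
    also have "norm \<dots> \<le> B"
      using assms(2)[OF n] assms(1) by (simp add: norm_divide norm_power field_simps)
    finally show "norm (\<Sum>z\<in>set_mset M'. of_nat (count M' z) * z ^ n) \<le> B" .
  qed
  then show ?thesis using assms(1) by (simp add: f_def norm_divide norm_power)
qed

section \<open>Frobenius-invariant multisets\<close>

definition frob :: "'a::{finite,field} alg_closure \<Rightarrow> 'a alg_closure" where
  "frob x = x ^ CARD('a)"

lemma frob_add: "frob (x + y) = frob x + frob y"
  using power_card_add[OF CHAR_ac, of x y 1] by (simp add: frob_def)

lemma frob_mult: "frob (x * y) = frob x * frob y"
  by (simp add: frob_def power_mult_distrib)

lemma frob_0 [simp]: "frob 0 = 0" and frob_1 [simp]: "frob 1 = 1"
  using CARD_ge_2[where ?'a='a] by (auto simp: frob_def power_0_left)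

lemma frob_uminus: "frob (- x) = - frob x"
  using frob_add[of x "-x"] by (simp add: eq_neg_iff_add_eq_0 add.commute)

lemma frob_sum: "frob (\<Sum>x\<in>A. f x) = (\<Sum>x\<in>A. frob (f x))"
  by (induction A rule: infinite_finite_induct) (auto simp: frob_add)

lemma frob_eq_0_iff: "frob x = 0 \<longleftrightarrow> x = 0"
  using CARD_ge_2[where ?'a='a] by (auto simp: frob_def)

lemma inj_frob: "inj frob"
proof (rule injI)
  fix x y :: "'a::{finite,field} alg_closure" assume "frob x = frob y"
  then have "frob (x - y) = 0" using frob_add[of x "-y"] by (simp add: frob_uminus)
  then show "x = y" by (simp add: frob_eq_0_iff)
qed

lemma frob_funpow: "(frob ^^ j) x = x ^ (CARD('a) ^ j)" for x :: "'a::{finite,field} alg_closure"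
  by (induction j) (simp_all add: frob_def mult.commute flip: power_mult)

lemma in_ext_field_iff: "x \<in> ext_field n \<longleftrightarrow> (frob ^^ n) x = x"
  by (simp add: ext_field_def frob_funpow)

lemma frob_eq_self_iff: "frob x = x \<longleftrightarrow> x \<in> range to_ac"
  by (simp add: in_range_to_ac_iff frob_def)

lemma frob_poly_ac_poly: "frob (poly (ac_poly f) x) = poly (ac_poly f) (frob x)"
  using poly_ac_poly_power_card[of f x 1] by (simp add: frob_def)

definition frob_multisets :: "nat \<Rightarrow> 'a::{finite,field} alg_closure multiset set" where
  "frob_multisets n = {M. size M = n \<and> image_mset frob M = M}"

definition monics :: "nat \<Rightarrow> 'a::{finite,field} poly set" where
  "monics n = {g. Polynomial.degree g = n \<and> lead_coeff g = 1}"

lemma finite_monics: "finite (monics n)"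
  by (rule finite_subset[OF _ finite_polys_lt[of "Suc n"]]) (auto simp: monics_def polys_lt_iff_degree)

lemma map_poly_frob_mult: "map_poly frob (p * q) = map_poly frob p * map_poly frob q"
  by (rule poly_eqI) (simp add: coeff_map_poly coeff_mult frob_sum frob_mult)

lemma map_poly_frob_prod_linear:
  "map_poly frob (\<Prod>x\<in>#M. [:-x, 1:]) = (\<Prod>x\<in>#image_mset frob M. [:-x, 1:])"
proof (induction M)
  case empty
  then show ?case by (simp add: poly_eq_iff coeff_map_poly)
next
  case (add x M)
  have "map_poly frob [:-x, 1:] = [:- frob x, 1:]"
    by (rule poly_eqI) (simp add: coeff_map_poly coeff_pCons frob_uminus split: nat.splits)
  then show ?case using add by (simp add: map_poly_frob_mult del: mult_pCons_left)
qed

text \<open>A product of linear factors has all coefficients in F_q exactly when Frobenius fixes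
  them, and Frobenius acts on the coefficients by acting on the multiset of roots.\<close>

lemma bij_betw_monics:
  "bij_betw (\<lambda>g. proots (ac_poly g)) (monics n) (frob_multisets n :: 'a::{finite,field} alg_closure multiset set)"
  unfolding bij_betw_def
proof (intro conjI inj_onI equalityI subsetI)
  fix g g' :: "'a poly" assume g: "g \<in> monics n" "g' \<in> monics n" "proots (ac_poly g) = proots (ac_poly g')"
  then have "lead_coeff (ac_poly g) = 1" "lead_coeff (ac_poly g') = 1" by (auto simp: monics_def)
  then have "ac_poly g = ac_poly g'" using prod_proots_eq_monic g(3) by metis
  then show "g = g'" by simp
next
  fix M assume "M \<in> (\<lambda>g. proots (ac_poly g)) ` (monics n :: 'a poly set)"
  then obtain g :: "'a poly" where g: "g \<in> monics n" "M = proots (ac_poly g)" by auto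
  have lc: "lead_coeff (ac_poly g) = 1" using g by (auto simp: monics_def)
  have "map_poly frob (ac_poly g) = ac_poly g"
    by (rule poly_eqI) (simp add: coeff_map_poly frob_eq_self_iff)
  then have "(\<Prod>x\<in>#image_mset frob M. [:-x, 1:]) = (\<Prod>x\<in>#M. [:-x, 1:])"
    unfolding map_poly_frob_prod_linear[symmetric] g(2) prod_proots_eq_monic[OF lc] .
  then have "image_mset frob M = M" by (metis proots_prod_linear_factors)
  then show "M \<in> frob_multisets n"
    using size_proots_monic[OF lc] g by (simp add: frob_multisets_def monics_def)
next
  fix M :: "'a alg_closure multiset" assume M: "M \<in> frob_multisets n"
  define P where "P = (\<Prod>x\<in>#M. [:-x, 1:])"
  define g where "g = map_poly of_ac P"
  have "map_poly frob P = P"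
    using map_poly_frob_prod_linear[of M] M by (simp add: P_def frob_multisets_def)
  then have "poly.coeff P i \<in> range to_ac" for i
    by (metis coeff_map_poly frob_0 frob_eq_self_iff)
  then have g: "ac_poly g = P"
    by (intro poly_eqI) (simp add: g_def coeff_map_poly to_ac_of_ac)
  have "Polynomial.degree P = n" "lead_coeff P = 1"
    using degree_prod_linear_factors[of M] monic_prod_linear_factors[of M] M by (auto simp: P_def frob_multisets_def)
  then have "g \<in> monics n"
    unfolding monics_def by (simp flip: g)
  moreover have "M = proots (ac_poly g)" by (simp only: g P_def proots_prod_linear_factors)
  ultimately show "M \<in> (\<lambda>g. proots (ac_poly g)) ` monics n" by blast
qed

lemma finite_frob_multisets: "finite (frob_multisets n)"
  using bij_betw_finite[OF bij_betw_monics] finite_monics by blast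

text \<open>A list of i conjugates with repetition: if x has degree e and i = t e, every conjugate
  occurs t times. For x in \<open>ext_field i\<close> this is the root multiset of P^t, P the
  minimal polynomial of x.\<close>

definition frob_orbit :: "nat \<Rightarrow> 'a::{finite,field} alg_closure \<Rightarrow> 'a alg_closure multiset" where
  "frob_orbit i x = image_mset (\<lambda>j. (frob ^^ j) x) (mset_set {..<i})"

lemma size_frob_orbit [simp]: "size (frob_orbit i x) = i"
  by (simp add: frob_orbit_def)

lemma frob_orbit_0 [simp]: "frob_orbit 0 x = {#}"
  by (simp add: frob_orbit_def)

lemma frob_orbit_Suc: "frob_orbit (Suc i) x = add_mset ((frob ^^ i) x) (frob_orbit i x)"
  by (simp add: frob_orbit_def lessThan_Suc)

text \<open>The orbit is peeled at its start instead of its end. If the i-th Frobenius iterate fixes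
  x, comparing the two forms gives invariance.\<close>

lemma frob_orbit_Suc': "frob_orbit (Suc i) x = add_mset x (image_mset frob (frob_orbit i x))"
proof (induction i)
  case (Suc i)
  have "frob_orbit (Suc (Suc i)) x = add_mset ((frob ^^ Suc i) x) (add_mset x (image_mset frob (frob_orbit i x)))"
    by (subst frob_orbit_Suc) (simp only: Suc)
  then show ?case unfolding frob_orbit_Suc[of i] by (simp add: add_mset_commute)
qed (simp add: frob_orbit_Suc)

lemma frob_orbit_in_frob_multisets:
  assumes "x \<in> ext_field i"
  shows "frob_orbit i x \<in> frob_multisets i"
  using frob_orbit_Suc[of i x] frob_orbit_Suc'[of i x] assms
  by (simp add: frob_multisets_def in_ext_field_iff)

lemma frob_orbit_add:
  assumes "x \<in> ext_field i"
  shows "frob_orbit (i + j) x = frob_orbit i x + frob_orbit j x"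
proof (induction j)
  case (Suc j)
  have "(frob ^^ (i + j)) x = (frob ^^ j) x"
    using assms by (simp add: add.commute[of i] funpow_add in_ext_field_iff)
  then show ?case using Suc by (simp add: frob_orbit_Suc)
qed simp

lemma ext_field_mult: "x \<in> ext_field e \<Longrightarrow> x \<in> ext_field (t * e)"
  by (induction t) (auto simp: in_ext_field_iff funpow_add)

lemma frob_orbit_mult:
  assumes "x \<in> ext_field e"
  shows "frob_orbit (t * e) x = repeat_mset t (frob_orbit e x)"
  by (induction t) (simp_all add: frob_orbit_add[OF assms])

text \<open>With e the degree of x, the admissible i are the multiples t e. All conjugates of x have
  the same multiplicity in M, so the orbit of length t e fits into M exactly for t <=
  \<open>count M x\<close>.\<close>

lemma card_frob_orbits_at_point:
  fixes M :: "'a::{finite,field} alg_closure multiset"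
  assumes M: "image_mset frob M = M" and x: "x \<in># M"
  shows "card {i. 0 < i \<and> x \<in> ext_field i \<and> frob_orbit i x \<subseteq># M} = count M x"
proof -
  have inj: "inj (frob ^^ j :: 'a alg_closure \<Rightarrow> _)" for j
    by (rule inj_fn[OF inj_frob])
  have cnt: "count M (frob y) = count M y" for y
  proof -
    have "count (image_mset frob N) (frob y) = count N y" for N :: "'a alg_closure multiset"
      by (induction N) (auto simp: inj_eq[OF inj_frob])
    then show ?thesis using M by metis
  qed
  have cnt': "count M ((frob ^^ j) y) = count M y" for j y
    by (induction j) (simp_all add: cnt)
  have ex: "\<exists>e>0. x \<in> ext_field e"
  proof -
    \<comment> \<open>All iterates stay in the finite support of M, so two coincide; injectivity of
      Frobenius makes x itself periodic.\<close>
    have "(\<lambda>j. (frob ^^ j) x) ` UNIV \<subseteq> set_mset M"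
      using cnt' x by (auto simp flip: count_greater_zero_iff)
    then have "\<not> inj (\<lambda>j. (frob ^^ j) x)"
      using finite_subset[of _ "set_mset M"] finite_imageD infinite_UNIV_nat by blast
    then obtain j k where jk: "j < k" "(frob ^^ j) x = (frob ^^ k) x"
      by (metis (mono_tags, lifting) injI linorder_neqE_nat)
    have "(frob ^^ k) x = (frob ^^ j) ((frob ^^ (k - j)) x)"
      using jk(1) by (metis comp_apply funpow_add le_add_diff_inverse less_imp_le)
    then have "(frob ^^ (k - j)) x = x" using jk(2) inj[of j] by (metis injD)
    then show ?thesis using jk(1) by (intro exI[of _ "k - j"]) (simp add: in_ext_field_iff)
  qed
  define e where "e = (LEAST e. e > 0 \<and> x \<in> ext_field e)"
  have e: "e > 0" "x \<in> ext_field e" using LeastI_ex[OF ex] by (auto simp: e_def)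
  have least: "e \<le> i" if "i > 0" "x \<in> ext_field i" for i
    using that unfolding e_def by (intro Least_le) auto
  have dvd: "e dvd i" if "x \<in> ext_field i" for i
  proof -
    have "(frob ^^ (i mod e)) ((frob ^^ (i div e * e)) x) = (frob ^^ i) x"
      by (metis comp_apply funpow_add mod_mult_div_eq mult.commute)
    then have "x \<in> ext_field (i mod e)"
      using that ext_field_mult[OF e(2), of "i div e"] by (simp add: in_ext_field_iff)
    then have "i mod e = 0" using least[of "i mod e"] e(1) by (metis gr0I leD mod_less_divisor)
    then show ?thesis by auto
  qed
  have inj_orb: "inj_on (\<lambda>j. (frob ^^ j) x) {..<e}"
  proof (rule linorder_inj_onI)
    fix j k assume jk: "j < k" "j \<in> {..<e}" "k \<in> {..<e}"
    show "(frob ^^ j) x \<noteq> (frob ^^ k) x"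
    proof
      assume eq: "(frob ^^ j) x = (frob ^^ k) x"
      have "(frob ^^ k) x = (frob ^^ j) ((frob ^^ (k - j)) x)"
        using jk(1) by (metis comp_apply funpow_add le_add_diff_inverse less_imp_le)
      then have "(frob ^^ (k - j)) x = x" using eq inj[of j] by (metis injD)
      then show False using least[of "k - j"] jk by (simp add: in_ext_field_iff)
    qed
  qed auto
  have orb: "frob_orbit e x = mset_set ((\<lambda>j. (frob ^^ j) x) ` {..<e})"
    unfolding frob_orbit_def by (rule image_mset_mset_set[OF inj_orb])
  have sub: "frob_orbit (t * e) x \<subseteq># M \<longleftrightarrow> t \<le> count M x" for t
  proof
    assume "frob_orbit (t * e) x \<subseteq># M"
    then have "count (frob_orbit (t * e) x) x \<le> count M x" by (rule mset_subset_eq_count)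
    moreover have "x \<in> (\<lambda>j. (frob ^^ j) x) ` {..<e}" using e(1) by (intro image_eqI[of _ _ 0]) auto
    ultimately show "t \<le> count M x" by (simp add: frob_orbit_mult[OF e(2)] orb)
  next
    assume "t \<le> count M x"
    then show "frob_orbit (t * e) x \<subseteq># M"
      unfolding subseteq_mset_def frob_orbit_mult[OF e(2)] orb by (auto simp: count_mset_set' cnt')
  qed
  have "{i. 0 < i \<and> x \<in> ext_field i \<and> frob_orbit i x \<subseteq># M} = (\<lambda>t. t * e) ` {1..count M x}"
  proof (intro equalityI subsetI)
    fix i assume i: "i \<in> {i. 0 < i \<and> x \<in> ext_field i \<and> frob_orbit i x \<subseteq># M}"
    then obtain t where t: "i = t * e" using dvd[of i] by (auto simp: mult.commute elim: dvdE)
    show "i \<in> (\<lambda>t. t * e) ` {1..count M x}" using i sub[of t] t by (intro image_eqI[of _ _ t]) auto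
  qed (use e sub ext_field_mult[OF e(2)] in auto)
  also have "card \<dots> = count M x" using e(1) by (subst card_image) (auto simp: inj_on_def)
  finally show ?thesis .
qed

text \<open>The polynomial analogue of summing the von Mangoldt function over the divisors of n to
  get log n: summing deg P over all prime powers P^t dividing g gives deg g.\<close>

lemma card_frob_orbits_below:
  fixes M :: "'a::{finite,field} alg_closure multiset"
  assumes "M \<in> frob_multisets n"
  shows "card {p \<in> Sigma {1..n} ext_field. frob_orbit (fst p) (snd p) \<subseteq># M} = n"
proof -
  have M: "size M = n" "image_mset frob M = M" using assms by (auto simp: frob_multisets_def)
  have in_M: "i \<le> n" "x \<in># M" if i0: "0 < i" and sub: "frob_orbit i x \<subseteq># M" for i x
  proof -
    show "i \<le> n" using size_mset_mono[OF sub] M by simp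
    obtain j where "i = Suc j" using i0 by (cases i) auto
    then have "x \<in># frob_orbit i x" by (simp add: frob_orbit_Suc')
    then show "x \<in># M" using sub by (rule mset_subset_eqD[rotated])
  qed
  define J where "J x = {i. 0 < i \<and> x \<in> ext_field i \<and> frob_orbit i x \<subseteq># M}" for x
  have finJ: "finite (J x)" for x
    by (rule finite_subset[of _ "{..n}"]) (use in_M in \<open>auto simp: J_def\<close>)
  have "card {p \<in> Sigma {1..n} ext_field. frob_orbit (fst p) (snd p) \<subseteq># M} = card (Sigma (set_mset M) J)"
    by (rule bij_betw_same_card[of prod.swap], rule bij_betwI[of _ _ _ prod.swap])
       (use in_M in \<open>auto simp: J_def Suc_le_eq\<close>)
  also have "\<dots> = (\<Sum>x\<in>set_mset M. card (J x))" using finJ by (subst card_SigmaI) auto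
  also have "\<dots> = (\<Sum>x\<in>set_mset M. count M x)"
    unfolding J_def by (intro sum.cong refl card_frob_orbits_at_point M)
  also have "\<dots> = n" using M by (simp add: size_multiset_overloaded_eq)
  finally show ?thesis .
qed

section \<open>The L-function and Weil's bound\<close>

lemma sum_in_range_to_ac:
  assumes "M \<in> frob_multisets n"
  shows "(\<Sum>x\<in>#M. poly (ac_poly f) x) \<in> range to_ac"
proof -
  have "frob (\<Sum>x\<in>#M. poly (ac_poly f) x) = (\<Sum>x\<in>#image_mset frob M. poly (ac_poly f) x)"
    by (induction M) (simp_all add: frob_add frob_poly_ac_poly)
  also have "image_mset frob M = M" using assms by (simp add: frob_multisets_def)
  finally show ?thesis by (simp add: frob_eq_self_iff)
qed

lemma sum_frob_orbit: "(\<Sum>y\<in>#frob_orbit i x. poly (ac_poly f) y) = ext_trace i (poly (ac_poly f) x)"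
proof -
  have "(\<Sum>y\<in>#frob_orbit i x. poly (ac_poly f) y) = (\<Sum>j<i. poly (ac_poly f) ((frob ^^ j) x))"
    unfolding frob_orbit_def by (simp add: image_mset.compositionality o_def sum_unfold_sum_mset)
  then show ?thesis by (simp add: ext_trace_def frob_funpow poly_ac_poly_power_card)
qed

text \<open>\<open>of_ac\<close> is used as an inverse of \<open>to_ac\<close> on its range only;
  hence the need to know that sums over invariant multisets and traces lie there.\<close>

lemma of_ac_add: "x \<in> range to_ac \<Longrightarrow> y \<in> range to_ac \<Longrightarrow> of_ac (x + y) = of_ac x + of_ac y"
  by (metis of_ac_to_ac rangeE to_ac_add)

context additive_character
begin

definition psi_mset :: "'a poly \<Rightarrow> 'a alg_closure multiset \<Rightarrow> complex" where
  "psi_mset f M = \<psi> (of_ac (\<Sum>x\<in>#M. poly (ac_poly f) x))"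

text \<open>The coefficient of T^n in the L-function: in terms of monic g of degree n, the sum of
  psi (sum of f over the roots of g).\<close>

definition L_coeff :: "'a poly \<Rightarrow> nat \<Rightarrow> complex" where
  "L_coeff f n = (\<Sum>M\<in>frob_multisets n. psi_mset f M)"

lemma psi_mset_union:
  "M \<in> frob_multisets m \<Longrightarrow> N \<in> frob_multisets n \<Longrightarrow> psi_mset f (M + N) = psi_mset f M * psi_mset f N"
  by (simp add: psi_mset_def of_ac_add sum_in_range_to_ac add)

lemma L_coeff_0 [simp]: "L_coeff f 0 = 1"
proof -
  have "frob_multisets 0 = {{#} :: 'a alg_closure multiset}" by (auto simp: frob_multisets_def)
  then show ?thesis by (simp add: L_coeff_def psi_mset_def)
qed

text \<open>Removing the orbit matches the multisets above it with all invariant multisets of size n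
  - i, and \<open>psi_mset\<close> turns unions into products.\<close>

lemma sum_psi_mset_above_orbit:
  assumes "x \<in> ext_field i" "i \<le> n"
  shows "(\<Sum>M\<in>{M\<in>frob_multisets n. frob_orbit i x \<subseteq># M}. psi_mset f M)
      = psi_mset f (frob_orbit i x) * L_coeff f (n - i)"
proof -
  let ?O = "frob_orbit i x"
  have O: "?O \<in> frob_multisets i" by (rule frob_orbit_in_frob_multisets[OF assms(1)])
  have "(\<Sum>M\<in>{M\<in>frob_multisets n. ?O \<subseteq># M}. psi_mset f M) = (\<Sum>N\<in>frob_multisets (n - i). psi_mset f (?O + N))"
  proof (rule sum.reindex_bij_witness[of _ "\<lambda>N. ?O + N" "\<lambda>M. M - ?O"])
    fix M assume M: "M \<in> {M \<in> frob_multisets n. ?O \<subseteq># M}"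
    then have "image_mset frob (M - ?O) = image_mset frob M - image_mset frob ?O"
      by (intro image_mset_Diff) auto
    then show "M - ?O \<in> frob_multisets (n - i)"
      using M O by (auto simp: frob_multisets_def size_Diff_submset)
  next
    fix N :: "'a alg_closure multiset" assume "N \<in> frob_multisets (n - i)"
    then show "?O + N \<in> {M \<in> frob_multisets n. ?O \<subseteq># M}"
      using O assms by (auto simp: frob_multisets_def)
  qed auto
  also have "\<dots> = psi_mset f ?O * L_coeff f (n - i)"
    by (simp add: psi_mset_union[OF O] L_coeff_def sum_distrib_left)
  finally show ?thesis .
qed

text \<open>Double counting of the pairs of a Frobenius orbit and an invariant multiset of size \<open>n\<close> above it;
  this is the logarithmic derivative of the Euler product.\<close>

lemma L_coeff_recurrence:
  "of_nat n * L_coeff f n = (\<Sum>i\<in>{1..n}. ext_sum f i * L_coeff f (n - i))"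
proof -
  define B where "B = (Sigma {1..n} ext_field :: (nat \<times> 'a alg_closure) set)"
  have finB: "finite B" unfolding B_def by (intro finite_SigmaI) (auto intro: finite_ext_field)
  have "of_nat n * L_coeff f n = (\<Sum>M\<in>frob_multisets n. of_nat n * psi_mset f M)"
    by (simp add: L_coeff_def sum_distrib_left)
  also have "\<dots> = (\<Sum>M\<in>frob_multisets n. \<Sum>p\<in>{p\<in>B. case p of (i, x) \<Rightarrow> frob_orbit i x \<subseteq># M}. psi_mset f M)"
  proof (intro sum.cong refl)
    fix M :: "'a alg_closure multiset" assume "M \<in> frob_multisets n"
    from card_frob_orbits_below[OF this]
    have "card {p\<in>B. case p of (i, x) \<Rightarrow> frob_orbit i x \<subseteq># M} = n"
      by (simp add: B_def case_prod_unfold)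
    then show "of_nat n * psi_mset f M = (\<Sum>p\<in>{p\<in>B. case p of (i, x) \<Rightarrow> frob_orbit i x \<subseteq># M}. psi_mset f M)"
      by simp
  qed
  also have "\<dots> = (\<Sum>p\<in>B. \<Sum>M\<in>{M\<in>frob_multisets n. case p of (i, x) \<Rightarrow> frob_orbit i x \<subseteq># M}. psi_mset f M)"
    by (rule sum.swap_restrict[OF finite_frob_multisets finB])
  also have "\<dots> = (\<Sum>(i, x)\<in>B. psi_mset f (frob_orbit i x) * L_coeff f (n - i))"
    by (intro sum.cong refl) (auto simp: B_def sum_psi_mset_above_orbit)
  also have "\<dots> = (\<Sum>i\<in>{1..n}. \<Sum>x\<in>ext_field i. psi_mset f (frob_orbit i x) * L_coeff f (n - i))"
    unfolding B_def by (rule sum.Sigma[symmetric]) (auto intro: finite_ext_field)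
  also have "\<dots> = (\<Sum>i\<in>{1..n}. ext_sum f i * L_coeff f (n - i))"
    by (simp add: ext_sum_def psi_mset_def sum_frob_orbit sum_distrib_right)
  finally show ?thesis .
qed

text \<open>The coefficient of X^(n-d) is the d-th elementary symmetric function of the roots up to
  sign, and the earlier ones do not move. A polynomial f of degree d sees nothing beyond the
  d-th.\<close>

lemma psi_mset_shift:
  fixes f g :: "'a poly"
  assumes "Polynomial.degree f = d" "0 < d" "d \<le> n" "g \<in> monics n"
  shows "g + monom t (n - d) \<in> monics n"
    and "psi_mset f (proots (ac_poly (g + monom t (n - d))))
      = \<psi> (- (lead_coeff f * of_nat d * t)) * psi_mset f (proots (ac_poly g))"
proof -
  let ?g = "g + monom t (n - d)"
  have "Polynomial.degree (monom t (n - d)) < Polynomial.degree g"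
    using assms degree_monom_le[of t "n - d"] by (simp add: monics_def)
  then have "Polynomial.degree ?g = n" using assms by (simp add: monics_def degree_add_eq_left)
  then show g': "?g \<in> monics n" using assms by (auto simp: monics_def)
  define M where "M = proots (ac_poly g)"
  define M' where "M' = proots (ac_poly ?g)"
  have lc: "lead_coeff (ac_poly g) = 1" "lead_coeff (ac_poly ?g) = 1"
    using g' assms(4) by (auto simp: monics_def)
  have size: "size M = n" "size M' = n"
    using size_proots_monic[OF lc(1)] size_proots_monic[OF lc(2)] g' assms(4)
    by (simp_all add: monics_def M_def M'_def)
  have nth: "fps_nth (rev_char_fps M) k = to_ac (poly.coeff g (n - k))"
            "fps_nth (rev_char_fps M') k = to_ac (poly.coeff ?g (n - k))" if "k \<le> n" for k
    using that rev_char_fps_nth(1)[of k M] rev_char_fps_nth(1)[of k M'] size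
    by (simp_all add: M_def M'_def prod_proots_eq_monic[OF lc(1)] prod_proots_eq_monic[OF lc(2)] del: coeff_add)
  have "(\<Sum>x\<in>#M'. poly (ac_poly f) x) = (\<Sum>x\<in>#M. poly (ac_poly f) x)
     - lead_coeff (ac_poly f) * of_nat d * (fps_nth (rev_char_fps M') d - fps_nth (rev_char_fps M) d)"
    by (rule sum_mset_poly_diff) (use assms size in \<open>auto simp: nth\<close>)
  also have "\<dots> = (\<Sum>x\<in>#M. poly (ac_poly f) x) + to_ac (- (lead_coeff f * of_nat d * t))"
    using assms by (simp add: nth)
  finally have eq: "(\<Sum>x\<in>#M'. poly (ac_poly f) x) = (\<Sum>x\<in>#M. poly (ac_poly f) x) + to_ac (- (lead_coeff f * of_nat d * t))" .
  have "M \<in> frob_multisets n" using bij_betwE[OF bij_betw_monics] assms(4) unfolding M_def by blast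
  then have rng: "(\<Sum>x\<in>#M. poly (ac_poly f) x) \<in> range to_ac" by (rule sum_in_range_to_ac)
  have "of_ac (\<Sum>x\<in>#M'. poly (ac_poly f) x)
      = of_ac (\<Sum>x\<in>#M. poly (ac_poly f) x) + (- (lead_coeff f * of_nat d * t))"
    unfolding eq by (simp only: of_ac_add[OF rng rangeI] of_ac_to_ac)
  then have "psi_mset f M' = \<psi> (- (lead_coeff f * of_nat d * t)) * psi_mset f M"
    by (simp only: psi_mset_def add mult.commute)
  then show "psi_mset f (proots (ac_poly ?g)) = \<psi> (- (lead_coeff f * of_nat d * t)) * psi_mset f (proots (ac_poly g))"
    by (simp only: M_def M'_def)
qed

lemma L_coeff_eq_0:
  assumes d: "Polynomial.degree f = d" "0 < d" "\<not> CHAR('a) dvd d" and n: "d \<le> n"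
  shows "L_coeff f n = 0"
proof -
  obtain y where y: "\<psi> y \<noteq> 1" using nontrivial by blast
  have nz: "lead_coeff f * of_nat d \<noteq> 0" using d by (auto simp: of_nat_eq_0_iff_char_dvd)
  \<comment> \<open>The shift by this t multiplies each summand by psi y, which is not 1; since it
    also permutes the monic polynomials, their sum vanishes.\<close>
  define t where "t = - y / (lead_coeff f * of_nat d)"
  have t: "- (lead_coeff f * of_nat d * t) = y" using nz by (simp add: t_def)
  let ?\<Psi> = "\<lambda>g. psi_mset f (proots (ac_poly g))"
  have eq: "L_coeff f n = (\<Sum>g\<in>monics n. ?\<Psi> g)"
    unfolding L_coeff_def by (rule sum.reindex_bij_betw[OF bij_betw_monics, symmetric])
  also have "\<dots> = (\<Sum>g\<in>monics n. ?\<Psi> (g + monom t (n - d)))"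
    by (rule sum.reindex_bij_witness[of _ "\<lambda>g. g + monom t (n - d)" "\<lambda>g. g + monom (- t) (n - d)"])
       (use psi_mset_shift(1)[OF d(1,2) n] in \<open>auto simp: add.assoc add_monom\<close>)
  also have "\<dots> = \<psi> y * (\<Sum>g\<in>monics n. ?\<Psi> g)"
    using psi_mset_shift(2)[OF d(1,2) n, of _ t] unfolding t by (simp add: sum_distrib_left)
  finally show ?thesis using y eq by simp
qed

text \<open>\<open>L_coeff\<close> satisfies the same recurrence with the sums S_n as Newton's
  identities give between \<open>rev_char_fps W\<close> and the negated power sums. As L has
  constant term 1, the recurrence determines S_n by induction.\<close>

lemma ext_sum_eq_power_sum:
  assumes d: "Polynomial.degree f = d" "0 < d" "\<not> CHAR('a) dvd d"
  obtains W :: "complex multiset" where "size W = d - 1" "\<And>n. n > 0 \<Longrightarrow> ext_sum f n = - power_sum W n"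
proof -
  \<comment> \<open>The reversal T^(d-1) L(1/T): it is monic because L_0 = 1, and for its roots w
    the product of all 1 - w T is L itself.\<close>
  define P where "P = Abs_poly (\<lambda>i. if i \<le> d - 1 then L_coeff f (d - 1 - i) else 0)"
  have coeff: "poly.coeff P i = (if i \<le> d - 1 then L_coeff f (d - 1 - i) else 0)" for i
    unfolding P_def by (subst Abs_poly_inverse) (auto simp: eventually_cofinite intro: finite_subset[of _ "{..d - 1}"])
  have deg: "Polynomial.degree P = d - 1"
    by (rule antisym[OF degree_le le_degree]) (auto simp: coeff)
  have lc: "lead_coeff P = 1" unfolding deg by (simp add: coeff)
  define W where "W = proots P"
  have size: "size W = d - 1" unfolding W_def using size_proots_monic[OF lc] deg by simp
  have nth: "fps_nth (rev_char_fps W) k = L_coeff f k" for k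
  proof (cases "k \<le> d - 1")
    case True
    have "fps_nth (rev_char_fps W) k = poly.coeff P (d - 1 - k)"
      using rev_char_fps_nth(1)[of k W] size True prod_proots_eq_monic[OF lc] by (simp add: W_def)
    then show ?thesis by (simp only: coeff diff_le_self if_True diff_diff_cancel[OF True])
  next
    case False
    then show ?thesis using rev_char_fps_nth(2)[of W k] size L_coeff_eq_0[OF d, of k] by simp
  qed
  have "ext_sum f n = - power_sum W n" if "n > 0" for n
    using that
  proof (induction n rule: less_induct)
    case (less n)
    obtain k where k: "n = Suc k" using less.prems by (cases n) auto
    have "of_nat (Suc k) * L_coeff f (Suc k) = (\<Sum>i\<in>{1..Suc k}. ext_sum f i * L_coeff f (Suc k - i))"
      by (rule L_coeff_recurrence)
    also have "\<dots> = (\<Sum>j\<le>k. L_coeff f j * ext_sum f (Suc k - j))"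
      by (rule sum.reindex_bij_witness[of _ "\<lambda>j. Suc k - j" "\<lambda>i. Suc k - i"]) auto
    also have "\<dots> = ext_sum f (Suc k) + (\<Sum>j\<in>{1..k}. L_coeff f j * ext_sum f (Suc k - j))"
    proof -
      have "{..k} = insert 0 {1..k}" by auto
      then show ?thesis by simp
    qed
    also have "(\<Sum>j\<in>{1..k}. L_coeff f j * ext_sum f (Suc k - j)) = (\<Sum>j\<in>{1..k}. L_coeff f j * - power_sum W (Suc k - j))"
      by (intro sum.cong refl arg_cong2[where f="(*)"] less.IH) (auto simp: k)
    finally have "of_nat (Suc k) * L_coeff f (Suc k)
        = ext_sum f (Suc k) + (\<Sum>j\<in>{1..k}. L_coeff f j * - power_sum W (Suc k - j))" .
    note eq = this
    show ?case unfolding k power_sum_Suc nth mult_minus_left eq by (simp add: sum_negf)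
  qed
  then show ?thesis using that size by blast
qed

theorem weil_bound:
  assumes "Polynomial.degree f > 0" "\<not> CHAR('a) dvd Polynomial.degree f"
  shows "norm (\<Sum>x\<in>UNIV. \<psi> (poly f x)) \<le> real (Polynomial.degree f - 1) * sqrt (real CARD('a))"
proof -
  define d where "d = Polynomial.degree f"
  have cop: "coprime d CARD('a)"
  proof -
    obtain e where e: "CARD('a) = CHAR('a) ^ e" using card_eq_CHAR_power by blast
    have "coprime d CHAR('a)" using assms(2) prime_CHAR[where ?'a='a]
      by (simp add: d_def coprime_commute prime_imp_coprime)
    then show ?thesis unfolding e by simp
  qed
  obtain W :: "complex multiset" where W: "size W = d - 1" "\<And>n. n > 0 \<Longrightarrow> ext_sum f n = - power_sum W n"
    using ext_sum_eq_power_sum[of f d] assms by (auto simp: d_def)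
  define B where "B = 2 * real CARD('a) * (2 * real d + 1)"
  have bd: "norm (power_sum W (2 * n)) \<le> B * real CARD('a) ^ n" if "n > 0" for n
    using norm_ext_sum_even_le[of f n] W(2)[of "2 * n"] that assms cop by (simp add: B_def d_def)
  have root: "norm w \<le> sqrt (real CARD('a))" if "w \<in># W" for w
    using norm_le_of_power_sums[OF _ bd that] by (simp add: real_le_rsqrt)
  have "(\<Sum>x\<in>UNIV. \<psi> (poly f x)) = ext_sum f 1"
  proof -
    have "ext_sum f 1 = (\<Sum>x\<in>range to_ac. \<psi> (of_ac (poly (ac_poly f) x)))"
      by (simp add: ext_sum_def range_to_ac ext_trace_def)
    also have "\<dots> = (\<Sum>x\<in>UNIV. \<psi> (poly f x))"
      by (subst sum.reindex[OF inj_to_ac]) (simp add: poly_ac_poly_to_ac)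
    finally show ?thesis ..
  qed
  also have "norm \<dots> = norm (\<Sum>w\<in>#W. w)" using W(2)[of 1] by (simp add: power_sum_def)
  also have "\<dots> \<le> real (size W) * sqrt (real CARD('a))"
    using root
  proof (induction W)
    case (add w W)
    have "norm (w + (\<Sum>w\<in>#W. w)) \<le> norm w + norm (\<Sum>w\<in>#W. w)" by (rule norm_triangle_ineq)
    also have "\<dots> \<le> sqrt (real CARD('a)) + real (size W) * sqrt (real CARD('a))"
      using add by (intro add_mono) auto
    finally show ?case by (simp add: algebra_simps)
  qed simp
  finally show ?thesis by (simp add: W d_def)
qed

end

section \<open>Diagonal systems\<close>

lemma sum_lists_prod:
  fixes h :: "'a::finite \<Rightarrow> 'b::comm_semiring_1"
  shows "(\<Sum>xs\<in>{xs. length xs = k}. \<Prod>i<k. h (xs ! i)) = (\<Sum>x\<in>UNIV. h x) ^ k"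
proof (induction k)
  case (Suc k)
  have "(\<Sum>xs\<in>{xs. length xs = Suc k}. \<Prod>i<Suc k. h (xs ! i))
      = (\<Sum>(x, xs)\<in>UNIV \<times> {xs. length xs = k}. \<Prod>i<Suc k. h ((x # xs) ! i))"
    by (rule sum.reindex_bij_witness[of _ "\<lambda>(x, xs). x # xs" "\<lambda>xs. (hd xs, tl xs)"])
       (auto simp: length_Suc_conv)
  also have "\<dots> = (\<Sum>x\<in>UNIV. \<Sum>xs\<in>{xs. length xs = k}. h x * (\<Prod>i<k. h (xs ! i)))"
    unfolding prod.lessThan_Suc_shift by (simp add: sum.cartesian_product)
  also have "\<dots> = (\<Sum>x\<in>UNIV. h x) ^ Suc k"
    by (simp add: Suc flip: sum_distrib_left sum_distrib_right)
  finally show ?case .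
qed simp

lemma finite_lists_of_length: "finite {xs :: 'a::finite list. length xs = k}"
  using finite_lists_length_eq[of "UNIV :: 'a set" k] by simp

context additive_character
begin

lemma sum_psi_PiE:
  assumes "finite J"
  shows "(\<Sum>u\<in>J \<rightarrow>\<^sub>E UNIV. \<psi> (\<Sum>j\<in>J. u j * c j)) = (if \<forall>j\<in>J. c j = 0 then of_nat CARD('a) ^ card J else 0)"
proof -
  have "(\<Sum>u\<in>J \<rightarrow>\<^sub>E UNIV. \<psi> (\<Sum>j\<in>J. u j * c j)) = (\<Sum>u\<in>J \<rightarrow>\<^sub>E UNIV. \<Prod>j\<in>J. \<psi> (c j * u j))"
    by (simp add: psi_sum mult.commute)
  also have "\<dots> = (\<Prod>j\<in>J. \<Sum>t\<in>UNIV. \<psi> (c j * t))"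
    by (rule prod_sum_PiE[symmetric]) (use assms in auto)
  also have "\<dots> = (if \<forall>j\<in>J. c j = 0 then of_nat CARD('a) ^ card J else 0)"
    using assms by (auto simp: sum_psi_mult)
  finally show ?thesis .
qed

text \<open>For fixed xs the sum over u detects whether all m equations hold, with weight q^m. For
  fixed u the exponent is a sum over the coordinates, so the sum over xs becomes a k-th
  power.\<close>

lemma card_diag_points_eq:
  fixes b :: "nat \<Rightarrow> 'a"
  shows "of_nat (CARD('a) ^ m * card (diag_points k m d b))
    = (\<Sum>u\<in>{1..m} \<rightarrow>\<^sub>E UNIV. \<psi> (- (\<Sum>j\<in>{1..m}. u j * b j)) * (\<Sum>x\<in>UNIV. \<psi> (\<Sum>j\<in>{1..m}. u j * x ^ d j)) ^ k)"
proof -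
  let ?X = "{xs :: 'a list. length xs = k}" and ?U = "{1..m} \<rightarrow>\<^sub>E (UNIV :: 'a set)"
  define c where "c xs j = (\<Sum>i<k. (xs ! i) ^ d j) - b j" for xs :: "'a list" and j
  have "of_nat (CARD('a) ^ m * card (diag_points k m d b))
      = (\<Sum>xs\<in>{xs\<in>?X. \<forall>j\<in>{1..m}. c xs j = 0}. of_nat CARD('a) ^ m :: complex)"
    by (simp add: diag_points_def c_def mult.commute)
  also have "\<dots> = (\<Sum>xs\<in>?X. if \<forall>j\<in>{1..m}. c xs j = 0 then of_nat CARD('a) ^ m else 0)"
    by (rule sum.inter_filter[OF finite_lists_of_length])
  also have "\<dots> = (\<Sum>xs\<in>?X. \<Sum>u\<in>?U. \<psi> (\<Sum>j\<in>{1..m}. u j * c xs j))"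
    by (simp only: sum_psi_PiE[OF finite_atLeastAtMost] card_atLeastAtMost diff_Suc_1)
  also have "\<dots> = (\<Sum>u\<in>?U. \<Sum>xs\<in>?X. \<psi> (\<Sum>j\<in>{1..m}. u j * c xs j))" by (rule sum.swap)
  also have "\<dots> = (\<Sum>u\<in>?U. \<psi> (- (\<Sum>j\<in>{1..m}. u j * b j)) * (\<Sum>x\<in>UNIV. \<psi> (\<Sum>j\<in>{1..m}. u j * x ^ d j)) ^ k)"
  proof (intro sum.cong refl)
    fix u :: "nat \<Rightarrow> 'a"
    have "\<psi> (\<Sum>j\<in>{1..m}. u j * c xs j)
        = \<psi> (- (\<Sum>j\<in>{1..m}. u j * b j)) * (\<Prod>i<k. \<psi> (\<Sum>j\<in>{1..m}. u j * (xs ! i) ^ d j))" for xs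
    proof -
      have "(\<Sum>j\<in>{1..m}. u j * c xs j) = - (\<Sum>j\<in>{1..m}. u j * b j) + (\<Sum>i<k. \<Sum>j\<in>{1..m}. u j * (xs ! i) ^ d j)"
        by (subst sum.swap) (simp add: c_def right_diff_distrib sum_subtractf sum_distrib_left)
      then show ?thesis by (simp only: add psi_sum)
    qed
    then show "(\<Sum>xs\<in>?X. \<psi> (\<Sum>j\<in>{1..m}. u j * c xs j))
        = \<psi> (- (\<Sum>j\<in>{1..m}. u j * b j)) * (\<Sum>x\<in>UNIV. \<psi> (\<Sum>j\<in>{1..m}. u j * x ^ d j)) ^ k"
      using sum_lists_prod[where k = k and h = "\<lambda>x. \<psi> (\<Sum>j\<in>{1..m}. u j * x ^ d j)"] by (simp flip: sum_distrib_left)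
  qed
  finally show ?thesis .
qed

text \<open>The exponents increase strictly, so the largest index l with u_l nonzero gives the
  degree d_l of the polynomial, again prime to p. The factor d_l - 1 of Weil's bound is then relaxed
  to d_m.\<close>

lemma norm_diag_sum_le:
  fixes u :: "nat \<Rightarrow> 'a"
  assumes mono: "\<And>i j. 1 \<le> i \<Longrightarrow> i < j \<Longrightarrow> j \<le> m \<Longrightarrow> d i < d j"
    and pos: "\<And>i. i \<in> {1..m} \<Longrightarrow> d i > 0"
    and CHAR: "\<And>i. i \<in> {1..m} \<Longrightarrow> \<not> CHAR('a) dvd d i"
    and u: "i0 \<in> {1..m}" "u i0 \<noteq> 0"
  shows "norm (\<Sum>x\<in>UNIV. \<psi> (\<Sum>j\<in>{1..m}. u j * x ^ d j)) \<le> real (d m) * sqrt (real CARD('a))"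
proof -
  define J where "J = {j\<in>{1..m}. u j \<noteq> 0}"
  define l where "l = Max J"
  have J: "finite J" "J \<noteq> {}" using u by (auto simp: J_def)
  have l: "l \<in> {1..m}" "u l \<noteq> 0" using Max_in[OF J] by (auto simp: l_def J_def)
  have above: "u j = 0" if "l < j" "j \<le> m" for j
  proof (rule ccontr)
    assume "u j \<noteq> 0"
    then have "j \<in> J" using that l by (simp add: J_def)
    then show False using Max_ge[OF J(1), of j] that by (simp add: l_def)
  qed
  define f where "f = (\<Sum>j\<in>{1..m}. monom (u j) (d j))"
  have coeff: "poly.coeff f n = (\<Sum>j\<in>{1..m}. if d j = n then u j else 0)" for n
    by (simp add: f_def coeff_sum)
  have "poly.coeff f (d l) = (\<Sum>j\<in>{1..m}. if j = l then u j else 0)"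
    unfolding coeff
  proof (intro sum.cong refl)
    fix j assume "j \<in> {1..m}"
    then have "d j = d l \<longleftrightarrow> j = l" using mono[of j l] mono[of l j] l
      by (cases j l rule: linorder_cases) auto
    then show "(if d j = d l then u j else 0) = (if j = l then u j else 0)" by simp
  qed
  then have "poly.coeff f (d l) \<noteq> 0" using l by simp
  then have "d l \<le> Polynomial.degree f" by (rule le_degree)
  moreover have "Polynomial.degree f \<le> d l"
  proof (rule degree_le, intro allI impI)
    fix n assume n: "d l < n"
    show "poly.coeff f n = 0" unfolding coeff
    proof (intro sum.neutral ballI)
      fix j assume j: "j \<in> {1..m}"
      show "(if d j = n then u j else 0) = 0"
        using above[of j] mono[of j l] j l n by (cases j l rule: linorder_cases) auto
    qed
  qed
  ultimately have deg: "Polynomial.degree f = d l" by simp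
  have dl: "d l \<le> d m" using mono[of l m] l by (cases "l = m") auto
  have "norm (\<Sum>x\<in>UNIV. \<psi> (poly f x)) \<le> real (Polynomial.degree f - 1) * sqrt (real CARD('a))"
    by (rule weil_bound) (use deg pos CHAR l in auto)
  also have "\<dots> \<le> real (d m) * sqrt (real CARD('a))"
    using dl deg by (intro mult_right_mono) auto
  finally show ?thesis by (simp add: f_def poly_sum poly_monom)
qed

lemma card_diag_points_bound:
  fixes b :: "nat \<Rightarrow> 'a"
  assumes "\<And>i j. 1 \<le> i \<Longrightarrow> i < j \<Longrightarrow> j \<le> m \<Longrightarrow> d i < d j"
    and "\<And>i. i \<in> {1..m} \<Longrightarrow> d i > 0"
    and "\<And>i. i \<in> {1..m} \<Longrightarrow> \<not> CHAR('a) dvd d i"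
    and "m \<le> k"
  shows "\<bar>real (card (diag_points k m d b)) - real CARD('a) ^ (k - m)\<bar> \<le> (real (d m) * sqrt (real CARD('a))) ^ k"
proof -
  define q where "q = real CARD('a)"
  have q: "q > 0" by (simp add: q_def)
  let ?U = "{1..m} \<rightarrow>\<^sub>E (UNIV :: 'a set)"
  define u0 where "u0 = (\<lambda>j\<in>{1..m}. 0 :: 'a)"
  define T where "T u = \<psi> (- (\<Sum>j\<in>{1..m}. u j * b j)) * (\<Sum>x\<in>UNIV. \<psi> (\<Sum>j\<in>{1..m}. u j * x ^ d j)) ^ k" for u :: "nat \<Rightarrow> 'a"
  have finU: "finite ?U" by (intro finite_PiE) auto
  have u0: "u0 \<in> ?U" by (auto simp: u0_def)
  have cardU: "real (card ?U) = q ^ m" by (simp add: card_PiE q_def)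
  have T0: "T u0 = of_real (q ^ k)" by (simp add: T_def u0_def q_def)
  have "of_nat (CARD('a) ^ m * card (diag_points k m d b)) = (\<Sum>u\<in>?U. T u)"
    unfolding T_def by (rule card_diag_points_eq)
  also have "\<dots> = T u0 + (\<Sum>u\<in>?U - {u0}. T u)" using finU u0 by (rule sum.remove)
  finally have "complex_of_real (q ^ m * real (card (diag_points k m d b)) - q ^ k) = (\<Sum>u\<in>?U - {u0}. T u)"
    by (simp add: T0 q_def)
  then have "\<bar>q ^ m * real (card (diag_points k m d b)) - q ^ k\<bar> = norm (\<Sum>u\<in>?U - {u0}. T u)"
    by (metis norm_of_real)
  \<comment> \<open>The tuple u0 = 0 gives the main term q^k. There are fewer than q^m other tuples,
    and this number cancels against the factor q^m in front of the point count.\<close>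
  also have "\<dots> \<le> real (card (?U - {u0})) * (real (d m) * sqrt q) ^ k"
  proof (rule sum_norm_bound)
    fix u assume u: "u \<in> ?U - {u0}"
    then obtain i0 where "i0 \<in> {1..m}" "u i0 \<noteq> 0"
      using PiE_ext[of u "{1..m}" "\<lambda>_. UNIV" u0] u0 by (auto simp: u0_def)
    then have "norm (\<Sum>x\<in>UNIV. \<psi> (\<Sum>j\<in>{1..m}. u j * x ^ d j)) \<le> real (d m) * sqrt q"
      unfolding q_def by (intro norm_diag_sum_le assms)
    then show "norm (T u) \<le> (real (d m) * sqrt q) ^ k"
      by (simp add: T_def norm_mult norm_power power_mono)
  qed
  also have "\<dots> \<le> q ^ m * (real (d m) * sqrt q) ^ k"
    using q card_mono[OF finU, of "?U - {u0}"] by (intro mult_right_mono) (auto simp flip: cardU)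
  finally have "\<bar>q ^ m * real (card (diag_points k m d b)) - q ^ k\<bar> \<le> q ^ m * (real (d m) * sqrt q) ^ k" .
  moreover have "q ^ m * real (card (diag_points k m d b)) - q ^ k = q ^ m * (real (card (diag_points k m d b)) - q ^ (k - m))"
    using assms(4) by (simp add: right_diff_distrib flip: power_add)
  ultimately show ?thesis using q by (simp add: abs_mult q_def)
qed

end

theorem theorem3p7:
  fixes k m :: nat and d :: "nat \<Rightarrow> nat" and b :: "nat \<Rightarrow> 'a::{finite,field}"
  assumes "k > 0" "m > 0"
    and "real m \<le> (real k - 1) / 2"
    and "2 \<le> d 1"
    and "\<And>i. 1 \<le> i \<Longrightarrow> i < m \<Longrightarrow> d i < d (i + 1)"
    and "\<And>i. i \<in> {1..m} \<Longrightarrow> \<not> CHAR('a) dvd d i"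
  shows "\<bar>real (card (diag_points k m d b)) - real (CARD('a)) ^ (k - m)\<bar>
    \<le> 3 ^ 3 * 2 ^ (m - 1) * (3 + real (d m) * real m) ^ (k + 1) * real (CARD('a)) powr (real k / 2)"
proof -
  have mono: "d i < d j" if "1 \<le> i" "i < j" "j \<le> m" for i j
    using that(2,3)
  proof (induction j)
    case (Suc j)
    then show ?case using assms(5)[of j] that(1) by (cases "i = j") (auto intro: less_trans)
  qed simp
  have pos: "d i > 0" if "i \<in> {1..m}" for i
    using mono[of 1 i] that assms(4) by (cases "i = 1") auto
  obtain \<psi> :: "'a \<Rightarrow> complex" where "additive_character \<psi>" using ex_additive_character by blast
  then interpret additive_character \<psi> .
  have mk: "m \<le> k" using assms(3) by (simp add: field_simps)
  have "\<bar>real (card (diag_points k m d b)) - real CARD('a) ^ (k - m)\<bar>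
      \<le> (real (d m) * sqrt (real CARD('a))) ^ k"
    by (rule card_diag_points_bound[OF mono pos assms(6) mk])
  also have "\<dots> = real (d m) ^ k * real CARD('a) powr (real k / 2)"
    by (simp add: power_mult_distrib powr_realpow powr_half_sqrt[symmetric] powr_powr flip: powr_realpow)
  \<comment> \<open>As m >= 1, d_m is at most 3 + d_m m; the additional power and the constants in
    front are at least 1.\<close>
  also have "\<dots> \<le> 3 ^ 3 * 2 ^ (m - 1) * (3 + real (d m) * real m) ^ (k + 1) * real CARD('a) powr (real k / 2)"
  proof (rule mult_right_mono)
    have dm: "real (d m) \<le> 3 + real (d m) * real m"
      using assms(2) mult_left_mono[of 1 "real m" "real (d m)"] by simp
    have "real (d m) ^ k \<le> (3 + real (d m) * real m) ^ k" by (intro power_mono dm) auto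
    also have "\<dots> \<le> (3 + real (d m) * real m) ^ (k + 1)" by (intro power_increasing) auto
    also have "\<dots> \<le> (3 ^ 3 * 2 ^ (m - 1)) * (3 + real (d m) * real m) ^ (k + 1)"
    proof -
      have "1 * 1 \<le> 3 ^ 3 * (2 :: real) ^ (m - 1)" by (intro mult_mono) auto
      then show ?thesis
        using mult_right_mono[of 1 "3 ^ 3 * (2 :: real) ^ (m - 1)" "(3 + real (d m) * real m) ^ (k + 1)"] by simp
    qed
    finally show "real (d m) ^ k \<le> 3 ^ 3 * 2 ^ (m - 1) * (3 + real (d m) * real m) ^ (k + 1)" .
  qed simp
  finally show ?thesis .
qed

end
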